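(* For any finite connected poset $P$ that is not a chain and any positive integer $k$, there exist non-negative integers $m_{P,k}$ and $m^*_{P,k}$ (depending only on $P$ and $k$) such that, as $n\to\infty$, $$\chi(G_P(\mathcal M_{n,k}))=\Theta(n^{m_{P,k}}),\qquad \chi(G^*_P(\mathcal M_{n,k}))=\Theta(n^{m^*_{P,k}}).$$
   Context: $[n]=\{1,\dots,n\}$ and $\binom{[n]}{j}$ is the family of $j$-element subsets of $[n]$. A poset is connected if its (undirected) Hasse diagram is a connected graph. A family $\mathcal G$ of sets is a weak copy of a poset $(P,\preceq)$ if there is a bijection $\iota:P\to\mathcal G$ such that $p\preceq q$ implies $\iota(p)\subseteq\iota(q)$; it is a strong copy if there is such a bijection with $p\preceq q$ if and only if $\iota(p)\subseteq\iota(q)$. For a family $\mathcal F$ of sets, $G_P(\mathcal F)$ (respectively $G_P^*(\mathcal F)$) is the graph on vertex set $\mathcal F$ in which distinct $F,G\in\mathcal F$ are adjacent if and only if there is a weak (respectively strong) copy of $P$ contained in $\mathcal F$ that contains both $F$ and $G$. $\mathcal M_{n,k}=\bigcup_{i=1}^k\binom{[n]}{\lfloor (n-k)/2\rfloor+i}$ is the family of the $k$ middle layers of $2^{[n]}$. $\chi$ is the chromatic number. *)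

theory Defs
  imports
    Complex_Main
    "HOL-Library.Landau_Symbols"
    "Graph_Theory.Graph_Theory"
begin

text \<open>
  A poset is a carrier \<open>P\<close> with a relation \<open>r\<close> such that \<open>partial_order_on P r\<close>, where
  \<open>(p, q) \<in> r\<close> is read as \<open>p \<preceq> q\<close>. The Hasse diagram has an arc from \<open>p\<close> to \<open>q\<close> when \<open>q\<close>
  covers \<open>p\<close>; the library notion \<open>connected\<close> for digraphs refers to the underlying
  undirected graph.
\<close>

definition hasse_diagram :: "'a set \<Rightarrow> 'a rel \<Rightarrow> 'a pair_pre_digraph" where
  "hasse_diagram P r =
    \<lparr> pverts = P,
      parcs = {(p, q). p \<in> P \<and> q \<in> P \<and> p \<noteq> q \<and> (p, q) \<in> r \<and>
                \<not> (\<exists>z\<in>P. z \<noteq> p \<and> z \<noteq> q \<and> (p, z) \<in> r \<and> (z, q) \<in> r)} \<rparr>"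

definition connected_poset :: "'a set \<Rightarrow> 'a rel \<Rightarrow> bool" where
  "connected_poset P r \<longleftrightarrow> connected (with_proj (hasse_diagram P r))"

definition weak_copy :: "'a set \<Rightarrow> 'a rel \<Rightarrow> 'b set set \<Rightarrow> bool" where
  "weak_copy P r \<G> \<longleftrightarrow>
    (\<exists>\<iota>. bij_betw \<iota> P \<G> \<and> (\<forall>p\<in>P. \<forall>q\<in>P. (p, q) \<in> r \<longrightarrow> \<iota> p \<subseteq> \<iota> q))"

definition strong_copy :: "'a set \<Rightarrow> 'a rel \<Rightarrow> 'b set set \<Rightarrow> bool" where
  "strong_copy P r \<G> \<longleftrightarrow>
    (\<exists>\<iota>. bij_betw \<iota> P \<G> \<and> (\<forall>p\<in>P. \<forall>q\<in>P. (p, q) \<in> r \<longleftrightarrow> \<iota> p \<subseteq> \<iota> q))"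

text \<open>Undirected graphs are represented by symmetric irreflexive arc sets.\<close>

definition weak_copy_graph :: "'a set \<Rightarrow> 'a rel \<Rightarrow> 'b set set \<Rightarrow> 'b set pair_pre_digraph" where
  "weak_copy_graph P r \<F> =
    \<lparr> pverts = \<F>,
      parcs = {(F, G). F \<in> \<F> \<and> G \<in> \<F> \<and> F \<noteq> G \<and>
                (\<exists>\<G>\<subseteq>\<F>. weak_copy P r \<G> \<and> F \<in> \<G> \<and> G \<in> \<G>)} \<rparr>"

definition strong_copy_graph :: "'a set \<Rightarrow> 'a rel \<Rightarrow> 'b set set \<Rightarrow> 'b set pair_pre_digraph" where
  "strong_copy_graph P r \<F> =
    \<lparr> pverts = \<F>,
      parcs = {(F, G). F \<in> \<F> \<and> G \<in> \<F> \<and> F \<noteq> G \<and>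
                (\<exists>\<G>\<subseteq>\<F>. strong_copy P r \<G> \<and> F \<in> \<G> \<and> G \<in> \<G>)} \<rparr>"

definition proper_coloring :: "'v pair_pre_digraph \<Rightarrow> nat \<Rightarrow> ('v \<Rightarrow> nat) \<Rightarrow> bool" where
  "proper_coloring G c f \<longleftrightarrow>
    (\<forall>v\<in>pverts G. f v < c) \<and> (\<forall>(u, v)\<in>parcs G. f u \<noteq> f v)"

text \<open>The minimum exists for every loop-free graph on finitely many vertices.\<close>

definition chromatic_number :: "'v pair_pre_digraph \<Rightarrow> nat" where
  "chromatic_number G = (LEAST c. \<exists>f. proper_coloring G c f)"

text \<open>
  The level sizes are integers because \<open>\<lfloor>(n - k) / 2\<rfloor> + i\<close> can be negative for \<open>n < k\<close>,
  in which case the level is empty.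
\<close>

definition middle_layers :: "nat \<Rightarrow> nat \<Rightarrow> nat set set" where
  "middle_layers n k =
    (\<Union>i\<in>{1..k}. {A. A \<subseteq> {1..n} \<and> int (card A) = \<lfloor>(real n - real k) / 2\<rfloor> + int i})"

end

theory Submission
  imports
    "HOL-Algebra.Algebraic_Closure_Type"
    "HOL-Library.Z2"
    "HOL-Library.Ramsey"
    Defs
begin

text \<open>
  Two members of a copy of \<open>P\<close> are joined by a path of comparabilities in \<open>P\<close>, and each step of
  the path changes a set by at most \<open>k\<close> elements on either side. So the distance \<open>card (F - G)\<close> of
  two members of a common layer is bounded in terms of \<open>P\<close> and \<open>k\<close>. Permuting the ground set maps
  copies to copies; hence, inside one layer, adjacency depends only on this distance. Adding a new
  element to all sets or to none shows that a distance that occurs for \<open>n\<close> in the \<open>i\<close>-th layer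
  occurs there for \<open>n + 1\<close> as well. The exponent \<open>m\<close> is the greatest distance that ever occurs in a
  layer, or 0 if none does. Weak and strong copies are treated at once in the locale
  \<open>copy_notion\<close>, whose assumptions are the two properties of copies used here.

  For the upper bound each of the \<open>k\<close> layers gets its own palette, and it remains to colour a layer
  with \<open>O(n ^ m)\<close> colours so that distinct sets at distance at most \<open>m\<close> are separated. This is a
  BCH code: place the ground set into the nonzero elements of a field of \<open>2 ^ e\<close> elements with
  \<open>n < 2 ^ e \<le> 2 * n\<close>, and colour \<open>F\<close> by the sums of the powers with exponents
  \<open>1, 3, ..., 2 * m - 1\<close> over \<open>F\<close> (lemma \<open>separating_colouring\<close>).

  For the lower bound no large clique need be available, since distances below \<open>m\<close> may fail to occur:
  for two four-dimensional Boolean lattices glued at their top elements and \<open>k = 5\<close>, the only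
  distance in the lowest layer is 4. What has to be shown is that separating the sets at distance
  exactly \<open>m\<close> already needs \<open>\<Omega>(n ^ m)\<close> colours. Words of a fixed length \<open>t\<close> over an alphabet of about
  \<open>n / (4 * t)\<close> letters embed into the layer with Hamming distance becoming set distance, so it
  suffices that a code in \<open>[q] ^ t\<close> without two words at Hamming distance exactly \<open>m\<close> has only
  \<open>O(q ^ (t - m))\<close> words (theorem \<open>forbidden_distance_bound\<close>). This is a relative of the theorem of
  Frankl and Fueredi on forbidding one intersection size, and it is proved by a delta-system
  argument. Call a set \<open>D\<close> of positions rich at a word if, among the code words that differ from it
  only inside \<open>D\<close>, many pairwise differ in all of \<open>D\<close>. A positive proportion of the code is uniform:
  every \<open>D\<close> is rich at all of its words or at none of them (lemma \<open>uniform_subcode\<close>). If \<open>t\<close> is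
  large, Ramsey's theorem yields a set \<open>Y\<close> of \<open>m\<close> positions such that the richness of a subset
  of \<open>Y\<close> depends only on its size. If no nonempty subset of \<open>Y\<close> is rich, then the sunflower lemma
  bounds the number of words with given letters outside \<open>Y\<close>, which gives the claim. Otherwise all
  subsets of \<open>Y\<close> of some positive size are rich; they cover \<open>Y\<close>, and stepping along them one after
  the other leads from any word to one that differs from it exactly on \<open>Y\<close>, at distance \<open>m\<close>.
\<close>

section \<open>Separating nearby sets by power sums in characteristic two\<close>

text \<open>
  The closure of the field with two elements contains the fields with \<open>2 ^ e\<close> elements for all \<open>e\<close> at
  once, so that \<open>e\<close> may vary with \<open>n\<close> inside a single type.
\<close>

type_synonym gf2_closure = "bit alg_closure"

lemma CHAR_gf2_closure: "CHAR(gf2_closure) = 2"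
proof -
  have "CHAR(bit) dvd 2" by (simp add: of_nat_eq_0_iff_char_dvd [symmetric])
  moreover have "CHAR(bit) \<noteq> 1" by simp
  moreover have "prime (2 :: nat)" by simp
  ultimately have "CHAR(bit) = 2" using prime_nat_iff[of 2] by auto
  thus ?thesis by (simp only: CHAR_alg_closure)
qed

lemma add_self_char2 [simp]: "x + x = (0 :: gf2_closure)"
proof -
  have "of_nat 2 = (0 :: gf2_closure)"
    by (simp only: of_nat_eq_0_iff_char_dvd CHAR_gf2_closure dvd_refl)
  thus ?thesis by (simp add: mult_2 [symmetric])
qed

lemma cancel_twice_char2: "p + r + (q + r) = p + (q :: gf2_closure)"
proof -
  have "p + r + (q + r) = p + q + (r + r)" by (simp only: ac_simps)
  thus ?thesis by simp
qed

lemma frobenius_sum_char2: "(\<Sum>x\<in>S. f x)\<^sup>2 = (\<Sum>x\<in>S. (f x :: gf2_closure)\<^sup>2)"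
  by (rule freshmans_dream_sum) (simp_all only: CHAR_gf2_closure two_is_prime_nat)

text \<open>
  The roots of \<open>X ^ (2 ^ e) - X\<close>, that is, the subfield with \<open>2 ^ e\<close> elements when \<open>e > 0\<close>.
\<close>

definition GF2 :: "nat \<Rightarrow> gf2_closure set" where
  "GF2 e = {x. x ^ (2 ^ e) = x}"

lemma GF2_0 [simp]: "0 \<in> GF2 e" by (simp add: GF2_def)

lemma GF2_add: "x \<in> GF2 e \<Longrightarrow> y \<in> GF2 e \<Longrightarrow> x + y \<in> GF2 e"
  unfolding GF2_def mem_Collect_eq
  by (subst freshmans_dream'[of _ e]) (simp_all only: CHAR_gf2_closure two_is_prime_nat)

lemma GF2_power: "x \<in> GF2 e \<Longrightarrow> x ^ j \<in> GF2 e"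
  by (simp add: GF2_def) (metis power_mult mult.commute)

lemma GF2_sum: "(\<And>x. x \<in> S \<Longrightarrow> f x \<in> GF2 e) \<Longrightarrow> (\<Sum>x\<in>S. f x) \<in> GF2 e"
  by (induction S rule: infinite_finite_induct) (simp_all add: GF2_add)

text \<open>
  The polynomial \<open>X ^ (2 ^ e) - X\<close> splits over the algebraic closure, and it has no double root
  because its derivative is the constant 1.
\<close>

lemma card_GF2:
  assumes "e > 0"
  shows "finite (GF2 e)" "card (GF2 e) = 2 ^ e"
proof -
  define p :: "gf2_closure poly" where "p = monom 1 (2 ^ e) - monom 1 1"
  have e1: "(1::nat) < 2 ^ e" using assms by (intro one_less_power) auto
  have deg: "degree p = 2 ^ e"
  proof -
    have "degree (- monom (1::gf2_closure) 1) < degree (monom (1::gf2_closure) (2 ^ e))"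
      using e1 by (simp add: degree_monom_eq)
    from degree_add_eq_left[OF this] show ?thesis by (simp add: p_def degree_monom_eq)
  qed
  hence p0: "p \<noteq> 0" by auto
  have dp: "pderiv p = [:1:]"
  proof -
    have "of_nat (2 ^ e) = (0 :: gf2_closure)"
      using assms by (simp only: of_nat_eq_0_iff_char_dvd CHAR_gf2_closure) simp
    moreover have "(-1 :: gf2_closure) = 1"
      using add_self_char2[of 1] by (simp only: eq_neg_iff_add_eq_0 eq_commute[of "-1"])
    ultimately show ?thesis
      by (simp add: p_def pderiv_diff pderiv_monom monom_0 del: of_nat_power of_nat_numeral)
  qed
  from alg_closed_imp_factorization[OF p0] obtain A
    where A: "size A = degree p" "p = smult (lead_coeff p) (\<Prod>x\<in>#A. [:-x, 1:])" by blast
  have cnt: "count A x \<le> 1" for x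
  proof (rule ccontr)
    assume "\<not> count A x \<le> 1"
    hence "count A x > 0" "count (A - {#x#}) x > 0" by (linarith, simp only: count_diff count_single, simp)
    hence "x \<in># A" "x \<in># A - {#x#}" by (simp_all only: count_greater_zero_iff)
    then obtain B where B: "A = add_mset x (add_mset x B)" by (metis insert_DiffM)
    define r where "r = smult (lead_coeff p) (\<Prod>y\<in>#B. [:-y, 1:])"
    have r: "p = [:-x,1:] * ([:-x,1:] * r)"
      by (subst A(2)) (simp only: B r_def image_mset_add_mset prod_mset.add_mset mult_smult_right)
    have "pderiv p = [:-x,1:] * (r + pderiv ([:-x,1:] * r))"
      unfolding r pderiv_mult[of "[:-x,1:]" "[:-x,1:] * r"] by (simp add: algebra_simps pderiv_pCons)
    hence "poly (pderiv p) x = 0" by simp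
    thus False by (simp add: dp)
  qed
  have roots: "GF2 e = set_mset A"
  proof -
    have "x \<in> GF2 e \<longleftrightarrow> poly p x = 0" for x by (simp add: GF2_def p_def poly_monom)
    moreover have "poly p x = 0 \<longleftrightarrow> x \<in># A" for x
    proof -
      have "poly (\<Prod>x\<in>#A. [:-x, 1:]) x = (\<Prod>y\<in>#A. x - y)"
        by (induction A) (auto simp: algebra_simps)
      thus ?thesis by (subst A(2)) (use p0 in \<open>auto simp: prod_mset_zero_iff\<close>)
    qed
    ultimately show ?thesis by auto
  qed
  show "finite (GF2 e)" by (simp add: roots)
  have "size A = card (set_mset A)"
  proof -
    have "count A x = 1" if "x \<in># A" for x using cnt[of x] that by (metis One_nat_def Suc_leI count_greater_zero_iff le_antisym)
    thus ?thesis by (simp add: size_multiset_overloaded_eq)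
  qed
  thus "card (GF2 e) = 2 ^ e" using A(1) deg roots by simp
qed

text \<open>
  The dual form of the BCH bound. Squaring is additive, so the vanishing of the odd power sums forces
  all power sums with exponents from 1 to \<open>2 * a\<close> to vanish, and with them the sum over \<open>S\<close> of every
  polynomial of degree at most \<open>2 * a\<close> without constant term. Such a polynomial can be chosen to vanish
  at all points of \<open>S\<close> but one.
\<close>

lemma odd_power_sums_separate:
  fixes g :: "'b \<Rightarrow> gf2_closure"
  assumes S: "finite S" "S \<noteq> {}" "card S \<le> 2 * a"
    and g: "inj_on g S" "\<And>x. x \<in> S \<Longrightarrow> g x \<noteq> 0"
    and odd_sums: "\<And>i. i < a \<Longrightarrow> (\<Sum>x\<in>S. g x ^ (2 * i + 1)) = 0"
  shows False
proof -
  have sums: "1 \<le> j \<Longrightarrow> j \<le> 2 * a \<Longrightarrow> (\<Sum>x\<in>S. g x ^ j) = 0" for j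
  proof (induction j rule: less_induct)
    case (less j)
    show ?case
    proof (cases "even j")
      case True
      then obtain l where l: "j = 2 * l" by blast
      have "(\<Sum>x\<in>S. g x ^ j) = (\<Sum>x\<in>S. g x ^ l)\<^sup>2"
        by (simp add: frobenius_sum_char2 l power_mult[symmetric] mult.commute)
      also have "\<dots> = 0" using less l by simp
      finally show ?thesis .
    next
      case False
      then obtain i where "j = 2 * i + 1" by (auto elim: oddE)
      thus ?thesis using odd_sums[of i] less.prems by simp
    qed
  qed
  obtain x0 where x0: "x0 \<in> S" using S by blast
  \<comment> \<open>The factor \<open>[:0, 1:]\<close> removes the constant term, about which the power sums say nothing.\<close>
  define Q where "Q = [:0, 1:] * (\<Prod>y\<in>S - {x0}. [:- g y, 1:])"
  have "degree (\<Prod>y\<in>S - {x0}. [:- g y, 1:]) \<le> card (S - {x0})"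
    using degree_prod_sum_le[of "S - {x0}" "\<lambda>y. [:- g y, 1:]"] S by simp
  hence deg: "degree Q \<le> 2 * a"
    using degree_mult_le[of "[:0,1:]" "\<Prod>y\<in>S - {x0}. [:- g y, 1:]"] S x0 card_gt_0_iff[of S]
    by (auto simp: Q_def card_Diff_singleton)
  have pQ: "poly Q z = z * (\<Prod>y\<in>S - {x0}. z - g y)" for z
    by (simp add: Q_def poly_prod)
  have "(\<Sum>x\<in>S. poly Q (g x)) = (\<Sum>x\<in>S. \<Sum>j\<le>degree Q. coeff Q j * g x ^ j)"
    by (simp add: poly_altdef)
  also have "\<dots> = (\<Sum>j\<le>degree Q. coeff Q j * (\<Sum>x\<in>S. g x ^ j))"
    by (subst sum.swap) (simp add: sum_distrib_left)
  also have "\<dots> = 0"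
  proof (rule sum.neutral, safe)
    fix j assume "j \<le> degree Q"
    show "coeff Q j * (\<Sum>x\<in>S. g x ^ j) = 0"
      by (cases "j = 0") (use sums[of j] \<open>j \<le> degree Q\<close> deg in \<open>auto simp: Q_def\<close>)
  qed
  finally have "(\<Sum>x\<in>S. poly Q (g x)) = 0" .
  moreover have "poly Q (g x) = 0" if "x \<in> S - {x0}" for x
    using that S by (auto simp: pQ)
  hence "(\<Sum>x\<in>S. poly Q (g x)) = poly Q (g x0)"
    using S x0 by (subst sum.remove[of S x0]) auto
  moreover have "poly Q (g x0) \<noteq> 0"
    using g x0 S by (auto simp: pQ inj_on_def)
  ultimately show False by simp
qed

text \<open>
  Distinct sets of equal size whose difference has at most \<open>a\<close> elements have a nonempty symmetric
  difference of at most \<open>2 * a\<close> elements; if the odd power sums over both sets agreed, those over the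
  symmetric difference would vanish. Using only \<open>a\<close> odd exponents, instead of all \<open>2 * a\<close>, is what
  keeps the number of colours at the order \<open>n ^ a\<close>.
\<close>

lemma separating_colouring:
  fixes n a :: nat
  assumes "n > 0"
  obtains c :: "nat set \<Rightarrow> nat"
    where "\<And>F. F \<subseteq> {1..n} \<Longrightarrow> c F < (2 * n) ^ a"
      "\<And>F G. F \<subseteq> {1..n} \<Longrightarrow> G \<subseteq> {1..n} \<Longrightarrow> card F = card G \<Longrightarrow> F \<noteq> G \<Longrightarrow> card (F - G) \<le> a
         \<Longrightarrow> c F \<noteq> c G"
proof -
  obtain e0 where e0: "2 ^ e0 \<le> n" "n < 2 ^ (e0 + 1)"
    using ex_power_ivl1[of 2 n] assms by auto
  define e where "e = e0 + 1"
  have e: "e > 0" "2 ^ e \<le> 2 * n" "n < 2 ^ e" using e0 by (auto simp: e_def)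
  have "card {1..n} \<le> card (GF2 e - {0})"
    using card_GF2[OF e(1)] e by (simp add: card_Diff_singleton)
  then obtain g where g: "inj_on g {1..n}" "g ` {1..n} \<subseteq> GF2 e - {0}"
    using card_le_inj[of "{1..n}" "GF2 e - {0}"] card_GF2[OF e(1)] by auto
  define syn where "syn F = (\<lambda>i\<in>{..<a}. \<Sum>x\<in>F. g x ^ (2 * i + 1))" for F
  define Z where "Z = ({..<a} \<rightarrow>\<^sub>E GF2 e)"
  have "finite Z" unfolding Z_def using card_GF2[OF e(1)] by (intro finite_PiE) auto
  then obtain b where b: "bij_betw b Z {0..<card Z}" using ex_bij_betw_finite_nat by blast
  have syn: "syn F \<in> Z" if "F \<subseteq> {1..n}" for F
  proof -
    have "g x ^ (2 * i + 1) \<in> GF2 e" if "x \<in> F" for x i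
      by (rule GF2_power) (use g that \<open>F \<subseteq> {1..n}\<close> in auto)
    hence "(\<Sum>x\<in>F. g x ^ (2 * i + 1)) \<in> GF2 e" for i
      by (rule GF2_sum)
    thus ?thesis unfolding syn_def Z_def by (intro restrict_PiE_iff[THEN iffD2]) simp
  qed
  show thesis
  proof (rule that[of "\<lambda>F. b (syn F)"])
    fix F :: "nat set"
    assume "F \<subseteq> {1..n}"
    hence "b (syn F) < card Z" using bij_betwE[OF b] syn by simp
    also have "card Z = (2 ^ e) ^ a" unfolding Z_def by (simp add: card_PiE card_GF2[OF e(1)])
    also have "\<dots> \<le> (2 * n) ^ a" using e by (intro power_mono) auto
    finally show "b (syn F) < (2 * n) ^ a" .
  next
    fix F G assume FG: "F \<subseteq> {1..n}" "G \<subseteq> {1..n}" "card F = card G" "F \<noteq> G" "card (F - G) \<le> a"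
    have fin: "finite F" "finite G" using FG finite_subset by blast+
    define S where "S = (F - G) \<union> (G - F)"
    have cFG: "card (G - F) = card (F - G)"
      using FG(3) fin by (simp add: card_Diff_subset_Int inf_commute)
    have "card S = card (F - G) + card (G - F)" unfolding S_def
      using fin by (intro card_Un_disjoint) auto
    hence cS: "card S \<le> 2 * a" using cFG FG(5) by simp
    show "b (syn F) \<noteq> b (syn G)"
    proof
      assume "b (syn F) = b (syn G)"
      hence eq: "syn F = syn G"
        using bij_betw_imp_inj_on[OF b] syn[OF FG(1)] syn[OF FG(2)] by (simp add: inj_on_eq_iff)
      have "(\<Sum>x\<in>S. g x ^ (2 * i + 1)) = 0" if "i < a" for i
      proof -
        let ?h = "\<lambda>x. g x ^ (2 * i + 1)"
        from eq have "(\<Sum>x\<in>F. ?h x) = (\<Sum>x\<in>G. ?h x)"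
          using that by (auto simp: syn_def dest!: fun_cong[of _ _ i])
        hence "0 = (\<Sum>x\<in>F. ?h x) + (\<Sum>x\<in>G. ?h x)" by simp
        \<comment> \<open>The common elements of the two sets cancel in characteristic two.\<close>
        also have "(\<Sum>x\<in>F. ?h x) = (\<Sum>x\<in>F - G. ?h x) + (\<Sum>x\<in>F \<inter> G. ?h x)"
          using fin by (metis add.commute sum.Int_Diff)
        also have "(\<Sum>x\<in>G. ?h x) = (\<Sum>x\<in>G - F. ?h x) + (\<Sum>x\<in>F \<inter> G. ?h x)"
          using fin by (metis add.commute sum.Int_Diff inf_commute)
        also have "(\<Sum>x\<in>F - G. ?h x) + (\<Sum>x\<in>F \<inter> G. ?h x) + ((\<Sum>x\<in>G - F. ?h x) + (\<Sum>x\<in>F \<inter> G. ?h x))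
          = (\<Sum>x\<in>F - G. ?h x) + (\<Sum>x\<in>G - F. ?h x)"
          by (rule cancel_twice_char2)
        also have "\<dots> = (\<Sum>x\<in>S. ?h x)" unfolding S_def
          using fin by (subst sum.union_disjoint) auto
        finally show ?thesis by simp
      qed
      moreover have "inj_on g S" by (rule inj_on_subset[OF g(1)]) (use FG in \<open>auto simp: S_def\<close>)
      moreover have "g x \<noteq> 0" if "x \<in> S" for x using that g FG by (auto simp: S_def)
      moreover have "finite S" "S \<noteq> {}" using fin FG(4) by (auto simp: S_def)
      ultimately show False using odd_power_sums_separate[of S a g] cS by blast
    qed
  qed
qed

section \<open>Codes without two words at a prescribed distance\<close>

definition diffs :: "('i \<Rightarrow> 'b) \<Rightarrow> ('i \<Rightarrow> 'b) \<Rightarrow> 'i set" where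
  "diffs x y = {i. x i \<noteq> y i}"

lemma diffs_commute: "diffs x y = diffs y x" unfolding diffs_def by metis

lemma diffs_triangle: "diffs x z \<subseteq> diffs x y \<union> diffs y z" by (auto simp: diffs_def)

lemma diffs_eq_empty_iff: "diffs x y = {} \<longleftrightarrow> x = y" by (simp add: diffs_def fun_eq_iff)

text \<open>
  The words of \<open>W\<close> form a sunflower: they share their letters outside \<open>D\<close> with \<open>x\<close> and have pairwise
  disjoint petals, one letter for each position in \<open>D\<close>. Richness at \<open>x\<close> depends only on the letters
  of \<open>x\<close> outside \<open>D\<close>, and \<open>x\<close> itself need not belong to the sunflower.
\<close>

definition rich :: "nat \<Rightarrow> ('i \<Rightarrow> 'b) set \<Rightarrow> 'i set \<Rightarrow> ('i \<Rightarrow> 'b) \<Rightarrow> bool" where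
  "rich s C D x \<longleftrightarrow> (\<exists>W\<subseteq>C. finite W \<and> card W = s \<and> (\<forall>w\<in>W. diffs x w \<subseteq> D) \<and>
                          (\<forall>u\<in>W. \<forall>v\<in>W. u \<noteq> v \<longrightarrow> diffs u v = D))"

lemma richI:
  assumes "W \<subseteq> C" "finite W" "card W = s" "\<And>w. w \<in> W \<Longrightarrow> diffs x w \<subseteq> D"
    and "\<And>u v. u \<in> W \<Longrightarrow> v \<in> W \<Longrightarrow> u \<noteq> v \<Longrightarrow> diffs u v = D"
  shows "rich s C D x"
  unfolding rich_def using assms by (intro exI[of _ W]) simp

lemma richE:
  assumes "rich s C D x"
  obtains W where "W \<subseteq> C" "finite W" "card W = s" "\<And>w. w \<in> W \<Longrightarrow> diffs x w \<subseteq> D"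
    "\<And>u v. u \<in> W \<Longrightarrow> v \<in> W \<Longrightarrow> u \<noteq> v \<Longrightarrow> diffs u v = D"
  using assms unfolding rich_def by metis

lemma rich_mono: "rich s C D x \<Longrightarrow> C \<subseteq> C' \<Longrightarrow> rich s C' D x"
  unfolding rich_def by (elim ex_forward) auto

text \<open>
  A position in \<open>D\<close> rules out at most one petal for agreeing with \<open>x\<close> and at most one for agreeing
  with \<open>y\<close>. With more than \<open>2 * card D\<close> petals one is left over, and it differs from both words in all
  of \<open>D\<close>.
\<close>

lemma rich_adds_differences:
  assumes "rich s C D y" "finite D" "2 * card D < s"
  shows "\<exists>z\<in>C. diffs x z = diffs x y \<union> D"
proof -
  obtain W where W: "W \<subseteq> C" "finite W" "card W = s" "\<And>w. w \<in> W \<Longrightarrow> diffs y w \<subseteq> D"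
    "\<And>u v. u \<in> W \<Longrightarrow> v \<in> W \<Longrightarrow> u \<noteq> v \<Longrightarrow> diffs u v = D"
    using richE[OF assms(1)] by metis
  define B where "B v = (\<Union>i\<in>D. {w\<in>W. w i = v i})" for v
  have one: "card {w\<in>W. w i = v i} \<le> 1" if "i \<in> D" for i v
  proof -
    have "u = u'" if "u \<in> W" "u' \<in> W" "u i = u' i" for u u'
      using W(5)[of u u'] that \<open>i \<in> D\<close> by (auto simp: diffs_def)
    thus ?thesis using W(2) by (simp add: card_le_Suc0_iff_eq)
  qed
  have B: "card (B v) \<le> card D" for v
  proof -
    have "card (B v) \<le> (\<Sum>i\<in>D. card {w\<in>W. w i = v i})"
      unfolding B_def using assms(2) by (rule card_UN_le)
    also have "\<dots> \<le> (\<Sum>i\<in>D. 1)" by (intro sum_mono one)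
    finally show ?thesis by simp
  qed
  have "card (B x \<union> B y) < card W"
    using card_Un_le[of "B x" "B y"] B[of x] B[of y] assms(3) W(3) by simp
  hence "\<not> W \<subseteq> B x \<union> B y"
    using W(2) card_mono[of "B x \<union> B y" W] assms(2) by (auto simp: B_def)
  then obtain z where z: "z \<in> W" "z \<notin> B x" "z \<notin> B y" by blast
  have "diffs x z = diffs x y \<union> D"
  proof -
    have "y i = z i" if "i \<notin> D" for i using W(4)[OF z(1)] that by (auto simp: diffs_def)
    moreover have "x i \<noteq> z i" "y i \<noteq> z i" if "i \<in> D" for i
      using z that unfolding B_def by force+
    ultimately show ?thesis unfolding diffs_def by auto metis+
  qed
  thus ?thesis using z W by blast
qed

text \<open>
  If several sets of positions are rich at every word of the code, then the steps can be concatenated: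
  each new step preserves the differences already made, even where the sets overlap.
\<close>

lemma rich_union_walk:
  assumes fin: "finite \<E>" and E: "\<And>D. D \<in> \<E> \<Longrightarrow> finite D \<and> 2 * card D < s"
    and rich: "\<And>x D. x \<in> C \<Longrightarrow> D \<in> \<E> \<Longrightarrow> rich s C D x" and x: "x \<in> C"
  shows "\<exists>z\<in>C. diffs x z = \<Union>\<E>"
  using fin subset_refl[of \<E>]
proof (induction \<E> rule: finite_subset_induct')
  case empty
  thus ?case using x by (auto simp: diffs_def)
next
  case (insert D F)
  then obtain y where y: "y \<in> C" "diffs x y = \<Union>F" by blast
  show ?case
    using rich_adds_differences[OF rich[OF y(1) insert(2)]] E[OF insert(2)] y(2) by (metis Union_insert sup_commute)
qed

text \<open>
  The Erdos-Rado sunflower lemma for words. A largest family of words that pairwise differ in all of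
  \<open>A\<close> has at most \<open>s\<close> members, and by maximality every word agrees with one of them somewhere in \<open>A\<close>.
  Fixing that letter leaves a problem with one position less.
\<close>

lemma sunflower_bound:
  assumes "finite A" "finite U" "\<And>x y. x \<in> U \<Longrightarrow> y \<in> U \<Longrightarrow> diffs x y \<subseteq> A"
    and "\<And>D x. D \<subseteq> A \<Longrightarrow> D \<noteq> {} \<Longrightarrow> x \<in> U \<Longrightarrow> \<not> rich s U D x"
  shows "card U \<le> s ^ card A * fact (card A)"
  using assms
proof (induction "card A" arbitrary: A U)
  case 0
  hence "\<forall>x\<in>U. \<forall>y\<in>U. x = y" by (simp add: diffs_eq_empty_iff)
  hence "card U \<le> 1" using 0 by (simp add: card_le_Suc0_iff_eq)
  thus ?case using 0 by simp
next
  case (Suc m A U)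
  define good where "good W \<longleftrightarrow> W \<subseteq> U \<and> (\<forall>u\<in>W. \<forall>v\<in>W. u \<noteq> v \<longrightarrow> diffs u v = A)" for W
  have "\<exists>W. good W \<and> (\<forall>V. good V \<longrightarrow> card V \<le> card W)"
  proof (rule ex_has_greatest_nat[of good "{}" card "card U + 1"])
    show "\<forall>V. good V \<longrightarrow> card V < card U + 1"
      using card_mono[OF Suc.prems(2)] by (auto simp: good_def less_Suc_eq_le)
  qed (simp add: good_def)
  then obtain W where W: "good W" "\<And>V. good V \<Longrightarrow> card V \<le> card W" by blast
  have finW: "finite W" using W Suc.prems(2) finite_subset by (auto simp: good_def)
  have cW: "card W \<le> s"
  proof (rule ccontr)
    assume "\<not> card W \<le> s"
    then obtain V where V: "V \<subseteq> W" "card V = s"  "finite V"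
      using obtain_subset_with_card_n[of s W] by (metis linorder_le_cases)
    obtain x where x: "x \<in> W" using \<open>\<not> card W \<le> s\<close> by fastforce
    have "rich s U A x"
    proof -
      have "diffs x w \<subseteq> A" if "w \<in> V" for w
        using Suc.prems(3)[of x w] that x V W(1) by (auto simp: good_def)
      moreover have "\<forall>u\<in>V. \<forall>v\<in>V. u \<noteq> v \<longrightarrow> diffs u v = A"
        using V(1) W(1) unfolding good_def by (meson subsetD)
      moreover have "V \<subseteq> U" using V(1) W(1) by (auto simp: good_def)
      ultimately show ?thesis using V by (intro richI[of V]) blast+
    qed
    moreover have "A \<noteq> {}" using Suc.hyps(2) by auto
    ultimately show False using Suc.prems(4) x W(1) by (auto simp: good_def)
  qed
  define Z where "Z w i = {x\<in>U. x i = w i}" for w i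
  have cov: "U \<subseteq> (\<Union>w\<in>W. \<Union>i\<in>A. Z w i)"
  proof
    fix x assume x: "x \<in> U"
    have "\<exists>w\<in>W. diffs x w \<noteq> A"
    proof (rule ccontr)
      assume H: "\<not> ?thesis"
      have "A \<noteq> {}" using Suc.hyps(2) by auto
      with H have "x \<notin> W" using diffs_eq_empty_iff[of x x] by metis
      moreover have "good (insert x W)"
        using H W(1) x by (auto simp: good_def diffs_commute)
      ultimately show False using W(2)[of "insert x W"] finW by simp
    qed
    then obtain w where w: "w \<in> W" "diffs x w \<noteq> A" by blast
    moreover have "diffs x w \<subseteq> A" using Suc.prems(3) x w W(1) by (auto simp: good_def)
    ultimately obtain i where "i \<in> A" "x i = w i" by (auto simp: diffs_def)
    thus "x \<in> (\<Union>w\<in>W. \<Union>i\<in>A. Z w i)" using x w by (auto simp: Z_def)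
  qed
  have Zb: "card (Z w i) \<le> s ^ m * fact m" if i: "i \<in> A" for w i
  proof -
    have cA: "card (A - {i}) = m" using Suc.hyps(2) Suc.prems(1) i by simp
    have "card (Z w i) \<le> s ^ card (A - {i}) * fact (card (A - {i}))"
    proof (rule Suc.hyps(1))
      show "m = card (A - {i})" by (simp add: cA)
      show "finite (A - {i})" using Suc.prems by simp
      show "finite (Z w i)" using Suc.prems by (simp add: Z_def)
      show "diffs x y \<subseteq> A - {i}" if "x \<in> Z w i" "y \<in> Z w i" for x y
        using that Suc.prems(3)[of x y] by (auto simp: Z_def diffs_def)
      show "\<not> rich s (Z w i) D x" if "D \<subseteq> A - {i}" "D \<noteq> {}" "x \<in> Z w i" for D x
        using that Suc.prems(4)[of D x] rich_mono[of s "Z w i" D x U] by (auto simp: Z_def)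
    qed
    thus ?thesis by (simp add: cA)
  qed
  have "card U \<le> card (\<Union>w\<in>W. \<Union>i\<in>A. Z w i)"
    using cov finW Suc.prems by (intro card_mono) (auto simp: Z_def)
  also have "\<dots> \<le> (\<Sum>w\<in>W. card (\<Union>i\<in>A. Z w i))" using finW by (rule card_UN_le)
  also have "\<dots> \<le> (\<Sum>w\<in>W. \<Sum>i\<in>A. card (Z w i))"
    using Suc.prems(1) by (intro sum_mono card_UN_le)
  also have "\<dots> \<le> (\<Sum>w\<in>W. \<Sum>i\<in>A. s ^ m * fact m)" by (intro sum_mono Zb)
  also have "\<dots> = card W * (Suc m * (s ^ m * fact m))" using Suc.hyps(2) by simp
  also have "\<dots> \<le> s * (Suc m * (s ^ m * fact m))" using cW by (rule mult_right_mono) simp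
  also have "\<dots> = s ^ Suc m * fact (Suc m)" by (simp add: algebra_simps)
  finally show ?case using Suc.hyps(2) by simp
qed

text \<open>
  The part \<open>R\<close> is closed: all sets in \<open>\<D>\<close> stay rich when only words of \<open>R\<close> are kept. The part \<open>Q D\<close>
  consists of words at which \<open>D\<close> is not rich, even within \<open>Q D\<close>.
\<close>

definition rich_poor_split ::
    "nat \<Rightarrow> 'i set set \<Rightarrow> ('i \<Rightarrow> 'b) set \<Rightarrow> ('i \<Rightarrow> 'b) set \<Rightarrow> ('i set \<Rightarrow> ('i \<Rightarrow> 'b) set) \<Rightarrow> bool" where
  "rich_poor_split s \<D> U R Q \<longleftrightarrow> U = R \<union> (\<Union>D\<in>\<D>. Q D) \<and> (\<forall>x\<in>R. \<forall>D\<in>\<D>. rich s R D x) \<and>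
     (\<forall>D\<in>\<D>. \<forall>x\<in>Q D. \<not> rich s (Q D) D x)"

text \<open>
  As long as the code is not closed, some \<open>D\<close> fails to be rich at some \<open>x\<close>, hence at all words that
  agree with \<open>x\<close> outside \<open>D\<close>. This whole fibre is moved to \<open>Q D\<close>. Moving complete fibres is essential:
  no later word of \<open>Q D\<close> lies in the same fibre, so that a new sunflower cannot arise in \<open>Q D\<close>.
\<close>

lemma rich_poor_split_exists:
  assumes "finite U"
  shows "\<exists>R Q. rich_poor_split s \<D> U R Q"
  using assms
proof (induction "card U" arbitrary: U rule: less_induct)
  case (less U)
  show ?case
  proof (cases "\<forall>x\<in>U. \<forall>D\<in>\<D>. rich s U D x")
    case True
    hence "rich_poor_split s \<D> U U (\<lambda>_. {})" by (simp add: rich_poor_split_def)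
    thus ?thesis by blast
  next
    case False
    then obtain x D where xD: "x \<in> U" "D \<in> \<D>" "\<not> rich s U D x" by blast
    define \<Phi> where "\<Phi> = {y\<in>U. diffs x y \<subseteq> D}"
    have "x \<in> \<Phi>" using xD by (simp add: \<Phi>_def diffs_def)
    hence "card (U - \<Phi>) < card U"
      using less.prems by (intro psubset_card_mono) (auto simp: \<Phi>_def)
    from less.hyps[OF this finite_Diff[OF less.prems]] obtain R Q
      where "rich_poor_split s \<D> (U - \<Phi>) R Q" by blast
    note RQ = this[unfolded rich_poor_split_def, THEN conjunct1]
      this[unfolded rich_poor_split_def, THEN conjunct2, THEN conjunct1]
      this[unfolded rich_poor_split_def, THEN conjunct2, THEN conjunct2]
    define Q' where "Q' = Q(D := Q D \<union> \<Phi>)"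
    have "\<not> rich s (Q D \<union> \<Phi>) D y" if y: "y \<in> Q D \<union> \<Phi>" for y
    proof
      assume "rich s (Q D \<union> \<Phi>) D y"
      then obtain W where W: "W \<subseteq> Q D \<union> \<Phi>" "finite W" "card W = s" "\<And>w. w \<in> W \<Longrightarrow> diffs y w \<subseteq> D"
        "\<And>u v. u \<in> W \<Longrightarrow> v \<in> W \<Longrightarrow> u \<noteq> v \<Longrightarrow> diffs u v = D"
        by (rule richE) (rule that)
      have "Q D \<subseteq> U - \<Phi>" unfolding RQ(1) using xD(2) by blast
      hence sub: "Q D \<union> \<Phi> \<subseteq> U" by (auto simp: \<Phi>_def)
      show False
      proof (cases "y \<in> \<Phi>")
        case True
        hence xy: "diffs x y \<subseteq> D" by (simp add: \<Phi>_def)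
        have "rich s U D x"
        proof (rule richI[OF _ W(2,3)])
          show "W \<subseteq> U" using W(1) sub by (rule subset_trans)
          show "diffs x w \<subseteq> D" if "w \<in> W" for w
            using diffs_triangle[of x w y] W(4)[OF that] xy by blast
        qed (rule W(5))
        thus False using xD(3) by contradiction
      next
        case False
        hence yQ: "y \<in> Q D" "y \<in> U" using y sub by blast+
        hence xy: "\<not> diffs x y \<subseteq> D" using False by (simp add: \<Phi>_def)
        have "w \<notin> \<Phi>" if "w \<in> W" for w
        proof
          assume "w \<in> \<Phi>"
          hence "diffs x w \<subseteq> D" by (simp add: \<Phi>_def)
          moreover have "diffs w y \<subseteq> D" using W(4)[OF that] by (subst diffs_commute)
          ultimately show False using diffs_triangle[of x y w] xy by blast
        qed
        hence "W \<subseteq> Q D" using W(1) by blast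
        hence "rich s (Q D) D y" by (rule richI[OF _ W(2,3,4,5)])
        thus False using RQ(3) xD(2) yQ(1) by simp
      qed
    qed
    hence "\<forall>E\<in>\<D>. \<forall>y\<in>Q' E. \<not> rich s (Q' E) E y" using RQ(3) by (auto simp: Q'_def)
    moreover have "U = R \<union> (\<Union>D\<in>\<D>. Q' D)"
    proof -
      have "\<D> = insert D \<D>" using xD(2) by blast
      hence "(\<Union>E\<in>\<D>. Q' E) = Q' D \<union> (\<Union>E\<in>\<D> - {D}. Q' E)" by blast
      also have "\<dots> = \<Phi> \<union> (Q D \<union> (\<Union>E\<in>\<D> - {D}. Q E))" by (simp add: Q'_def Un_ac)
      also have "Q D \<union> (\<Union>E\<in>\<D> - {D}. Q E) = (\<Union>E\<in>\<D>. Q E)" using xD(2) by blast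
      finally have "R \<union> (\<Union>E\<in>\<D>. Q' E) = \<Phi> \<union> (U - \<Phi>)" unfolding RQ(1) by blast
      also have "\<dots> = U" by (auto simp: \<Phi>_def)
      finally show ?thesis ..
    qed
    ultimately have "rich_poor_split s \<D> U R Q'" using RQ(2) by (simp add: rich_poor_split_def)
    thus ?thesis by blast
  qed
qed

text \<open>
  One of the \<open>card \<D> + 1\<close> parts of a split contains at least the corresponding share of the code. If it
  is the closed part, all of \<open>\<D>\<close> is rich; otherwise one set is poor throughout, it remains so in every
  subcode, and induction deals with the other sets.
\<close>

lemma uniform_subcode:
  assumes "finite C" "finite \<D>"
  shows "\<exists>C'\<subseteq>C. card C \<le> fact (card \<D> + 1) * card C' \<and>
           (\<forall>D\<in>\<D>. (\<forall>x\<in>C'. rich s C' D x) \<or> (\<forall>x\<in>C'. \<not> rich s C' D x))"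
  using assms
proof (induction "card \<D>" arbitrary: \<D> C)
  case 0
  hence "\<D> = {}" by simp
  thus ?case by (intro exI[of _ C]) simp
next
  case (Suc d \<D> C)
  note cD = Suc.hyps(2)[symmetric]
  obtain R Q where "rich_poor_split s \<D> C R Q"
    using rich_poor_split_exists[OF Suc.prems(1)] by blast
  note RQ = this[unfolded rich_poor_split_def, THEN conjunct1]
    this[unfolded rich_poor_split_def, THEN conjunct2, THEN conjunct1]
    this[unfolded rich_poor_split_def, THEN conjunct2, THEN conjunct2]
  show ?case
  proof (cases "card C \<le> (d + 2) * card R")
    case True
    have "card C \<le> fact (card \<D> + 1) * card R"
    proof -
      have "(d + 2) * card R \<le> fact (d + 2) * card R"
        by (intro mult_right_mono fact_ge_self) simp
      with True have "card C \<le> fact (d + 2) * card R" by (rule le_trans)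
      thus ?thesis by (simp add: cD)
    qed
    moreover have "R \<subseteq> C" using RQ(1) by blast
    ultimately show ?thesis using RQ(2) by (intro exI[of _ R]) simp
  next
    case False
    have "\<exists>D\<in>\<D>. card C \<le> (d + 2) * card (Q D)"
    proof (rule ccontr)
      assume "\<not> ?thesis"
      hence H: "(d + 2) * card (Q D) \<le> card C" if "D \<in> \<D>" for D using that by force
      have "card C \<le> card R + card (\<Union>D\<in>\<D>. Q D)" unfolding RQ(1) by (rule card_Un_le)
      also have "\<dots> \<le> card R + (\<Sum>D\<in>\<D>. card (Q D))"
        using Suc.prems(2) by (intro add_left_mono card_UN_le)
      finally have "(d + 2) * card C \<le> (d + 2) * (card R + (\<Sum>D\<in>\<D>. card (Q D)))"
        by (rule mult_le_mono2)
      also have "\<dots> = (d + 2) * card R + (\<Sum>D\<in>\<D>. (d + 2) * card (Q D))"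
        by (simp only: add_mult_distrib2 sum_distrib_left)
      also have "\<dots> \<le> (d + 2) * card R + (\<Sum>D\<in>\<D>. card C)" using H by (intro add_left_mono sum_mono)
      also have "\<dots> < card C + (\<Sum>D\<in>\<D>. card C)" using False by simp
      also have "\<dots> = (d + 2) * card C" by (simp add: cD)
      finally show False by simp
    qed
    then obtain D where D: "D \<in> \<D>" "card C \<le> (d + 2) * card (Q D)" by blast
    have sub: "Q D \<subseteq> C" using RQ(1) D(1) by blast
    have "d = card (\<D> - {D})" using Suc.prems(2) D(1) by (simp add: cD)
    from Suc.hyps(1)[OF this finite_subset[OF sub Suc.prems(1)] finite_Diff[OF Suc.prems(2)]]
    obtain C' where C': "C' \<subseteq> Q D" "card (Q D) \<le> fact (card (\<D> - {D}) + 1) * card C'"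
      "\<forall>E\<in>\<D> - {D}. (\<forall>x\<in>C'. rich s C' E x) \<or> (\<forall>x\<in>C'. \<not> rich s C' E x)" by blast
    have "\<forall>x\<in>C'. \<not> rich s C' D x"
      using C'(1) RQ(3) D(1) rich_mono[OF _ C'(1)] by (meson subsetD)
    with C'(3) have "\<forall>E\<in>\<D>. (\<forall>x\<in>C'. rich s C' E x) \<or> (\<forall>x\<in>C'. \<not> rich s C' E x)"
      by (metis Diff_iff singletonD)
    moreover have "card C \<le> fact (card \<D> + 1) * card C'"
    proof -
      have "card (Q D) \<le> fact (d + 1) * card C'"
        using C'(2) \<open>d = card (\<D> - {D})\<close> by simp
      hence "(d + 2) * card (Q D) \<le> (d + 2) * (fact (d + 1) * card C')" by (rule mult_le_mono2)
      also have "\<dots> = fact (card \<D> + 1) * card C'" by (simp add: cD algebra_simps)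
      finally show ?thesis using D(2) by simp
    qed
    ultimately show ?thesis using C'(1) sub by (intro exI[of _ C']) simp
  qed
qed

definition homogeneous :: "'x set set \<Rightarrow> nat \<Rightarrow> 'x set \<Rightarrow> bool" where
  "homogeneous J r Y \<longleftrightarrow>
     (\<forall>D\<subseteq>Y. card D = r \<longrightarrow> D \<in> J) \<or> (\<forall>D\<subseteq>Y. card D = r \<longrightarrow> D \<notin> J)"

lemma homogeneous_subset: "homogeneous J r Y \<Longrightarrow> Y' \<subseteq> Y \<Longrightarrow> homogeneous J r Y'"
  unfolding homogeneous_def using subset_trans[of _ Y' Y] by metis

text \<open>
  Ramsey's theorem for \<open>r\<close>-subsets and two colours, carried over from initial segments of the natural
  numbers to arbitrary finite sets.
\<close>

lemma ramsey_two_colour: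
  fixes r p :: nat
  shows "\<exists>N. \<forall>(Z::'x set) J. finite Z \<longrightarrow> N \<le> card Z \<longrightarrow> (\<exists>Y\<subseteq>Z. card Y = p \<and> homogeneous J r Y)"
proof -
  obtain N :: nat where N: "partn_lst {..<N} [p, p] r" using ramsey_full by blast
  show ?thesis
  proof (intro exI[of _ N] allI impI)
    fix Z :: "'x set" and J assume Z: "finite Z" "N \<le> card Z"
    obtain h where h: "inj_on h {..<N}" "h ` {..<N} \<subseteq> Z"
      using card_le_inj[of "{..<N}" Z] Z by auto
    define f where "f D = (if h ` D \<in> J then 0 else (1::nat))" for D
    have "f \<in> nsets {..<N} r \<rightarrow> {..<2}" by (auto simp: f_def)
    from partn_lstE[OF N this] obtain i H where iH: "i < 2" "H \<in> nsets {..<N} ([p, p] ! i)"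
      "f ` nsets H r \<subseteq> {i}" by (metis length_Cons list.size(3) numeral_2_eq_2)
    have H: "H \<subseteq> {..<N}" "finite H" "card H = p"
      using iH(1,2) by (auto simp: nsets_def less_2_cases_iff)
    have inj: "inj_on h H" using inj_on_subset[OF h(1) H(1)] .
    have key: "\<exists>D'. D = h ` D' \<and> D' \<in> nsets H r" if "D \<subseteq> h ` H" "card D = r" for D
    proof -
      from that(1) obtain D' where D': "D' \<subseteq> H" "D = h ` D'" by (auto simp: subset_image_iff)
      moreover have "card D' = r" using that D' card_image[OF inj_on_subset[OF inj D'(1)]] by simp
      moreover have "finite D'" using D'(1) H(2) by (rule finite_subset)
      ultimately show ?thesis unfolding nsets_def by blast
    qed
    have "homogeneous J r (h ` H)"
    proof (cases "i = 0")
      case True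
      have "D \<in> J" if "D \<subseteq> h ` H" "card D = r" for D
        using key[OF that] iH(3) True by (auto simp: f_def image_subset_iff split: if_splits)
      thus ?thesis by (simp add: homogeneous_def)
    next
      case False
      have "D \<notin> J" if "D \<subseteq> h ` H" "card D = r" for D
        using key[OF that] iH(3) False by (auto simp: f_def image_subset_iff split: if_splits)
      thus ?thesis by (simp add: homogeneous_def)
    qed
    moreover have "h ` H \<subseteq> Z" using h(2) H(1) by blast
    moreover have "card (h ` H) = p" using card_image[OF inj] H by simp
    ultimately show "\<exists>Y\<subseteq>Z. card Y = p \<and> homogeneous J r Y" by blast
  qed
qed

text \<open>
  The sizes are treated one after the other, each inside the set found for the previous ones.
\<close>

lemma ramsey_all_small_sizes:
  fixes a p :: nat
  shows "\<exists>N. \<forall>(Z::'x set) J. finite Z \<longrightarrow> N \<le> card Z \<longrightarrow> (\<exists>Y\<subseteq>Z. card Y = p \<and>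
           (\<forall>j<a. homogeneous J j Y))"
proof (induction a arbitrary: p)
  case 0
  show ?case by (intro exI[of _ p]) (auto intro: obtain_subset_with_card_n)
next
  case (Suc a)
  obtain M where M: "\<And>(Z::'x set) J. finite Z \<Longrightarrow> M \<le> card Z \<Longrightarrow> (\<exists>Y\<subseteq>Z. card Y = p \<and> homogeneous J a Y)"
    using ramsey_two_colour[where 'x='x, of p a] by meson
  obtain N where N: "\<And>(Z::'x set) J. finite Z \<Longrightarrow> N \<le> card Z \<Longrightarrow> (\<exists>Y\<subseteq>Z. card Y = M \<and>
           (\<forall>j<a. homogeneous J j Y))"
    using Suc[of M] by meson
  show ?case
  proof (intro exI[of _ N] allI impI)
    fix Z :: "'x set" and J assume Z: "finite Z" "N \<le> card Z"
    from N[OF this, of J] obtain Y where Y: "Y \<subseteq> Z" "card Y = M"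
      "\<forall>j<a. homogeneous J j Y" by blast
    have "finite Y" using Y(1) Z(1) finite_subset by blast
    from M[OF this, of J] Y(2) obtain Y' where Y': "Y' \<subseteq> Y" "card Y' = p"
      "homogeneous J a Y'" by auto
    show "\<exists>Y\<subseteq>Z. card Y = p \<and>
           (\<forall>j<Suc a. homogeneous J j Y)"
    proof (intro exI[of _ Y'] conjI allI impI)
      fix j assume "j < Suc a"
      show "homogeneous J j Y'"
      proof (cases "j = a")
        case False
        hence "j < a" using \<open>j < Suc a\<close> by simp
        thus ?thesis using Y(3) Y'(1) homogeneous_subset by blast
      qed (use Y'(3) in simp)
    qed (use Y Y' in auto)
  qed
qed

text \<open>
  The length \<open>t\<close> and the constant \<open>K\<close> depend only on \<open>a\<close>, while the alphabet may grow: \<open>t\<close> is a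
  Ramsey number. The exponent cannot be improved, since Reed-Solomon codes have \<open>q ^ (t - a)\<close> words
  and all their distances exceed \<open>a\<close>.
\<close>

theorem forbidden_distance_bound:
  fixes a :: nat
  assumes "a > 0"
  obtains t K :: nat where "a \<le> t" "\<And>q C. C \<subseteq> {..<t} \<rightarrow>\<^sub>E {..<q::nat} \<Longrightarrow>
     (\<And>x y. x \<in> C \<Longrightarrow> y \<in> C \<Longrightarrow> card (diffs x y) \<noteq> a) \<Longrightarrow> card C \<le> K * q ^ (t - a)"
proof -
  obtain t where t: "\<And>(Z::nat set) J. finite Z \<Longrightarrow> t \<le> card Z \<Longrightarrow> (\<exists>Y\<subseteq>Z. card Y = a \<and>
       (\<forall>j<Suc a. homogeneous J j Y))"
    using ramsey_all_small_sizes[where 'x=nat, of a "Suc a"] by meson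
  define \<D> where "\<D> = Pow {..<t} - {{}}"
  \<comment> \<open>More petals than \<open>rich_adds_differences\<close> asks for, whatever the set of positions.\<close>
  define s where "s = 2 * t + 1"
  define K where "K = fact (card \<D> + 1) * (s ^ a * fact a)"
  have "a \<le> t"
  proof -
    obtain Y where "Y \<subseteq> {..<t}" "card Y = a" using t[of "{..<t}" "{}"] by auto
    thus ?thesis using card_mono[of "{..<t}" Y] by simp
  qed
  moreover have "card C \<le> K * q ^ (t - a)"
    if C: "C \<subseteq> {..<t} \<rightarrow>\<^sub>E {..<q::nat}" and avoid: "\<And>x y. x \<in> C \<Longrightarrow> y \<in> C \<Longrightarrow> card (diffs x y) \<noteq> a" for q C
  proof -
    have finC: "finite C" using C finite_subset by (metis finite_PiE finite_lessThan)
    have "finite \<D>" by (simp add: \<D>_def)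
    from uniform_subcode[OF finC this, of s] obtain C' where C': "C' \<subseteq> C"
      "card C \<le> fact (card \<D> + 1) * card C'"
      "\<And>D. D \<in> \<D> \<Longrightarrow> (\<forall>x\<in>C'. rich s C' D x) \<or> (\<forall>x\<in>C'. \<not> rich s C' D x)" by blast
    define J where "J = {D. \<forall>x\<in>C'. rich s C' D x}"
    obtain Y where Y: "Y \<subseteq> {..<t}" "card Y = a"
      and hom: "\<And>j. j \<le> a \<Longrightarrow> homogeneous J j Y"
      using t[of "{..<t}" J] by (auto simp: less_Suc_eq_le)
    have finY: "finite Y" using Y(1) finite_subset by blast
    have finC': "finite C'" using finC C'(1) finite_subset by blast
    have poor: "\<not> rich s C' D x" if D: "D \<subseteq> Y" "D \<noteq> {}" and x: "x \<in> C'" for D x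
    proof (cases "D \<in> J")
      case False
      moreover have "D \<in> \<D>" using D Y(1) by (auto simp: \<D>_def)
      ultimately show ?thesis using C'(3) x unfolding J_def by blast
    next
      case True
      define j where "j = card D"
      have finD: "finite D" using D finY finite_subset by blast
      have j: "j \<le> a" "j > 0"
        using D finY Y(2) card_mono[OF finY D(1)] finD by (auto simp: j_def card_gt_0_iff)
      \<comment> \<open>All sets of the size of \<open>D\<close> are rich as well, and together they cover \<open>Y\<close>.\<close>
      define \<E> where "\<E> = {E. E \<subseteq> Y \<and> card E = j}"
      have EJ: "\<E> \<subseteq> J" using hom[OF j(1)] True D unfolding homogeneous_def \<E>_def j_def by blast
      have "\<Union>\<E> = Y"
      proof
        show "Y \<subseteq> \<Union>\<E>"
        proof
          fix y assume y: "y \<in> Y"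
          have "j - 1 \<le> card (Y - {y})" using j Y(2) finY y by simp
          then obtain E where E: "E \<subseteq> Y - {y}" "card E = j - 1" "finite E"
            using obtain_subset_with_card_n by metis
          have "insert y E \<in> \<E>" using E y j by (auto simp: \<E>_def card_insert_if)
          thus "y \<in> \<Union>\<E>" by blast
        qed
      qed (auto simp: \<E>_def)
      moreover have "\<exists>z\<in>C'. diffs x z = \<Union>\<E>"
      proof (rule rich_union_walk[where s = s])
        show "finite \<E>" using finY by (simp add: \<E>_def)
        show "finite E \<and> 2 * card E < s" if "E \<in> \<E>" for E
          using that finY finite_subset j \<open>a \<le> t\<close> by (auto simp: \<E>_def s_def)
        show "rich s C' E y" if "y \<in> C'" "E \<in> \<E>" for y E using that EJ unfolding J_def by blast
      qed (rule x)
      ultimately obtain z where "z \<in> C'" "card (diffs x z) = a" using Y(2) by metis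
      thus ?thesis using avoid x C'(1) by blast
    qed
    define \<pi> where "\<pi> x = restrict x ({..<t} - Y)" for x :: "nat \<Rightarrow> nat"
    define \<B> where "\<B> = ({..<t} - Y) \<rightarrow>\<^sub>E {..<q}"
    have "card ({..<t} - Y) = t - a" using Y finY by (simp add: card_Diff_subset)
    hence cB: "finite \<B>" "card \<B> = q ^ (t - a)"
      by (auto simp: \<B>_def card_PiE intro: finite_PiE)
    have "\<pi> ` C' \<subseteq> \<B>" using C C'(1) by (fastforce simp: \<pi>_def \<B>_def PiE_iff)
    hence "C' = (\<Union>b\<in>\<B>. {x\<in>C'. \<pi> x = b})" by blast
    hence "card C' \<le> (\<Sum>b\<in>\<B>. card {x\<in>C'. \<pi> x = b})"
      using card_UN_le[OF cB(1)] by metis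
    also have "\<dots> \<le> (\<Sum>b\<in>\<B>. s ^ card Y * fact (card Y))"
    proof (intro sum_mono sunflower_bound)
      fix b D x
      show "\<not> rich s {x \<in> C'. \<pi> x = b} D x" if "D \<subseteq> Y" "D \<noteq> {}" "x \<in> {x \<in> C'. \<pi> x = b}"
        using poor[of D x] that rich_mono[of s "{x \<in> C'. \<pi> x = b}" D x C'] by blast
    next
      fix b x y assume xy: "x \<in> {x \<in> C'. \<pi> x = b}" "y \<in> {x \<in> C'. \<pi> x = b}"
      show "diffs x y \<subseteq> Y"
      proof
        fix i assume i: "i \<in> diffs x y"
        show "i \<in> Y"
        proof (rule ccontr)
          assume "i \<notin> Y"
          have mem: "x \<in> {..<t} \<rightarrow>\<^sub>E {..<q}" "y \<in> {..<t} \<rightarrow>\<^sub>E {..<q}" using xy C C'(1) by auto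
          have "x i = y i"
          proof (cases "i < t")
            case True
            have "\<pi> x i = \<pi> y i" using xy by simp
            thus ?thesis using True \<open>i \<notin> Y\<close> by (simp add: \<pi>_def)
          next
            case False
            thus ?thesis using PiE_arb[OF mem(1), of i] PiE_arb[OF mem(2), of i] by simp
          qed
          thus False using i by (simp add: diffs_def)
        qed
      qed
    qed (use finY finC' in auto)
    also have "\<dots> = s ^ a * fact a * q ^ (t - a)" by (simp add: cB Y(2))
    finally have "card C' \<le> s ^ a * fact a * q ^ (t - a)" .
    hence "card C \<le> fact (card \<D> + 1) * (s ^ a * fact a * q ^ (t - a))"
      using C'(2) by (meson le_trans mult_le_mono2)
    thus ?thesis by (simp only: K_def mult.assoc)
  qed
  ultimately show thesis by (rule that)
qed

section \<open>Words inside one layer\<close>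

text \<open>
  The first \<open>t * q\<close> elements of the ground set are cut into \<open>t\<close> blocks of \<open>q\<close> elements, and a word
  selects one element of each block. The \<open>h - t\<close> elements that follow belong to every set and only
  adjust the size.
\<close>

definition word_set :: "nat \<Rightarrow> nat \<Rightarrow> nat \<Rightarrow> (nat \<Rightarrow> nat) \<Rightarrow> nat set" where
  "word_set q t h x = (\<lambda>i. Suc (i * q + x i)) ` {..<t} \<union> {t * q<..t * q + (h - t)}"

lemma word_set_properties:
  fixes q t h :: nat
  assumes "t \<le> h" and x: "x \<in> {..<t} \<rightarrow>\<^sub>E {..<q}" and y: "y \<in> {..<t} \<rightarrow>\<^sub>E {..<q}"
  shows word_set_subset: "word_set q t h x \<subseteq> {1..t * q + (h - t)}"
    and card_word_set: "card (word_set q t h x) = h"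
    and card_word_set_diff: "card (word_set q t h x - word_set q t h y) = card (diffs x y)"
proof -
  have lt: "z i < q" if "z \<in> {..<t} \<rightarrow>\<^sub>E {..<q}" "i < t" for z i
    using that by (auto simp: PiE_iff)
  have top: "Suc (i * q + z i) \<le> t * q" if "z \<in> {..<t} \<rightarrow>\<^sub>E {..<q}" "i < t" for z i
  proof -
    have "Suc (i * q + z i) \<le> Suc i * q" using lt[OF that] by simp
    also have "\<dots> \<le> t * q" using that(2) by (intro mult_right_mono) auto
    finally show ?thesis .
  qed
  have dec: "i = j \<and> z i = w j" if "z \<in> {..<t} \<rightarrow>\<^sub>E {..<q}" "w \<in> {..<t} \<rightarrow>\<^sub>E {..<q}" "i < t" "j < t"
    "i * q + z i = j * q + w j" for z w i j
  proof -
    have "(i * q + z i) div q = i" "(j * q + w j) div q = j"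
      using lt[OF that(1,3)] lt[OF that(2,4)] by simp_all
    hence "i = j" using that(5) by simp
    thus ?thesis using that(5) by simp
  qed
  show "word_set q t h x \<subseteq> {1..t * q + (h - t)}"
  proof -
    have "Suc (i * q + x i) \<le> t * q + (h - t)" if "i < t" for i
      using top[OF x that] by linarith
    thus ?thesis by (auto simp: word_set_def)
  qed
  have inj: "inj_on (\<lambda>i. Suc (i * q + x i)) S" if "S \<subseteq> {..<t}" for S
    using that dec[OF x x] by (auto simp: inj_on_def subset_iff)
  have "card (word_set q t h x) = card ((\<lambda>i. Suc (i * q + x i)) ` {..<t}) + card {t * q<..t * q + (h - t)}"
    unfolding word_set_def
  proof (rule card_Un_disjoint)
    show "(\<lambda>i. Suc (i * q + x i)) ` {..<t} \<inter> {t * q<..t * q + (h - t)} = {}"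
      using top[OF x] by fastforce
  qed auto
  also have "\<dots> = h" using inj[of "{..<t}"] \<open>t \<le> h\<close> by (simp add: card_image)
  finally show "card (word_set q t h x) = h" .
  have "x i = y i" if "\<not> i < t" for i
    using PiE_arb[OF x, of i] PiE_arb[OF y, of i] that by simp
  hence sub: "diffs x y \<subseteq> {..<t}" by (auto simp: diffs_def not_less[symmetric])
  have "word_set q t h x - word_set q t h y = (\<lambda>i. Suc (i * q + x i)) ` diffs x y"
  proof (intro equalityI subsetI)
    fix v assume v: "v \<in> word_set q t h x - word_set q t h y"
    then obtain i where i: "i < t" "v = Suc (i * q + x i)" by (auto simp: word_set_def)
    hence "x i \<noteq> y i" using v by (auto simp: word_set_def)
    thus "v \<in> (\<lambda>i. Suc (i * q + x i)) ` diffs x y" using i by (auto simp: diffs_def)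
  next
    fix v assume "v \<in> (\<lambda>i. Suc (i * q + x i)) ` diffs x y"
    then obtain i where i: "i \<in> diffs x y" "v = Suc (i * q + x i)" by blast
    hence "i < t" using sub by auto
    have "v \<notin> word_set q t h y"
    proof
      assume "v \<in> word_set q t h y"
      then consider j where "j < t" "v = Suc (j * q + y j)" | "t * q < v"
        by (auto simp: word_set_def)
      thus False
      proof cases
        case 1
        thus False using dec[OF x y \<open>i < t\<close> 1(1)] i by (auto simp: diffs_def)
      next
        case 2
        thus False using top[OF x \<open>i < t\<close>] i by simp
      qed
    qed
    thus "v \<in> word_set q t h x - word_set q t h y" using i \<open>i < t\<close> by (auto simp: word_set_def)
  qed
  thus "card (word_set q t h x - word_set q t h y) = card (diffs x y)"
    using card_image[OF inj[OF sub]] by simp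
qed

text \<open>
  The \<open>q ^ t\<close> words are partitioned into \<open>M\<close> colour classes, each of which is a code that avoids
  distance \<open>a\<close> and thus has at most \<open>K * q ^ (t - a)\<close> words.
\<close>

lemma exact_distance_colours:
  fixes a :: nat
  assumes "a > 0"
  obtains t K :: nat where "t > 0" "\<And>n h q M (f :: nat set \<Rightarrow> nat). q > 0 \<Longrightarrow> t \<le> h \<Longrightarrow> t * q + h \<le> n + t \<Longrightarrow>
    (\<And>F. F \<subseteq> {1..n} \<Longrightarrow> card F = h \<Longrightarrow> f F < M) \<Longrightarrow>
    (\<And>F G. F \<subseteq> {1..n} \<Longrightarrow> G \<subseteq> {1..n} \<Longrightarrow> card F = h \<Longrightarrow> card G = h \<Longrightarrow> card (F - G) = a \<Longrightarrow> f F \<noteq> f G)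
    \<Longrightarrow> q ^ a \<le> K * M"
proof (rule forbidden_distance_bound[OF assms])
  fix t K :: nat
  assume t: "a \<le> t" and bound: "\<And>q C. C \<subseteq> {..<t} \<rightarrow>\<^sub>E {..<q::nat} \<Longrightarrow>
     (\<And>x y. x \<in> C \<Longrightarrow> y \<in> C \<Longrightarrow> card (diffs x y) \<noteq> a) \<Longrightarrow> card C \<le> K * q ^ (t - a)"
  show thesis
  proof (rule that[of t K])
    show "t > 0" using t assms by simp
    fix n h q M and f :: "nat set \<Rightarrow> nat"
    assume q: "q > 0" and h: "t \<le> h" "t * q + h \<le> n + t"
      and fM: "\<And>F. F \<subseteq> {1..n} \<Longrightarrow> card F = h \<Longrightarrow> f F < M"
      and fne: "\<And>F G. F \<subseteq> {1..n} \<Longrightarrow> G \<subseteq> {1..n} \<Longrightarrow> card F = h \<Longrightarrow> card G = h \<Longrightarrow> card (F - G) = a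
        \<Longrightarrow> f F \<noteq> f G"
    define W where "W = ({..<t} \<rightarrow>\<^sub>E {..<q})"
    have sub: "word_set q t h x \<subseteq> {1..n}" if "x \<in> W" for x
      using word_set_subset[OF h(1), of x q x] that h by (fastforce simp: W_def)
    have cd: "card (word_set q t h x) = h" if "x \<in> W" for x
      using card_word_set[OF h(1), of x q x] that by (simp add: W_def)
    define C where "C c = {x\<in>W. f (word_set q t h x) = c}" for c
    have "finite W" by (simp add: W_def finite_PiE)
    have "card (C c) \<le> K * q ^ (t - a)" for c
    proof (rule bound)
      show "C c \<subseteq> {..<t} \<rightarrow>\<^sub>E {..<q}" by (auto simp: C_def W_def)
      fix x y assume xy: "x \<in> C c" "y \<in> C c"
      hence W: "x \<in> W" "y \<in> W" by (auto simp: C_def)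
      have "card (word_set q t h x - word_set q t h y) \<noteq> a"
        using fne[OF sub[OF W(1)] sub[OF W(2)] cd[OF W(1)] cd[OF W(2)]] xy by (auto simp: C_def)
      thus "card (diffs x y) \<noteq> a" using card_word_set_diff[OF h(1), of x q y] W by (simp add: W_def)
    qed
    moreover have "W = (\<Union>c<M. C c)" using fM[OF sub cd] by (auto simp: C_def)
    ultimately have "card W \<le> (\<Sum>c<M. K * q ^ (t - a))"
      using card_UN_le[of "{..<M}" C] sum_mono[of "{..<M}" "\<lambda>c. card (C c)" "\<lambda>_. K * q ^ (t - a)"]
      by (metis finite_lessThan le_trans)
    also have "card W = q ^ a * q ^ (t - a)"
      using t by (simp add: W_def card_PiE power_add [symmetric])
    also have "(\<Sum>c<M. K * q ^ (t - a)) = (K * M) * q ^ (t - a)" by simp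
    finally show "q ^ a \<le> K * M" using q by simp
  qed
qed

text \<open>
  The three cardinalities determine the sizes of the four parts into which the two sets divide \<open>U\<close>,
  and a permutation can be put together from bijections between corresponding parts.
\<close>

lemma permutation_between_pairs:
  assumes U: "finite U" and sub: "F \<subseteq> U" "G \<subseteq> U" "F' \<subseteq> U" "G' \<subseteq> U"
    and cards: "card F = card F'" "card G = card G'" "card (F - G) = card (F' - G')"
  obtains \<pi> where "inj_on \<pi> U" "\<pi> ` U = U" "\<pi> ` F = F'" "\<pi> ` G = G'"
proof -
  have fin: "finite F" "finite G" "finite F'" "finite G'" using U sub finite_subset by blast+
  have split: "card A = card (A \<inter> B) + card (A - B)" if "finite A" for A B :: "'a set"
    using that by (metis card_Diff_subset_Int card_mono finite_Int inf_le1 le_add_diff_inverse)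
  have c1: "card (F \<inter> G) = card (F' \<inter> G')"
    using split[OF fin(1), of G] split[OF fin(3), of G'] cards by simp
  hence c3: "card (G - F) = card (G' - F')"
    using split[OF fin(2), of F] split[OF fin(4), of F'] cards by (simp add: Int_commute)
  have "card (F \<union> G) = card (F' \<union> G')"
    using c1 cards card_Un_Int[OF fin(1,2)] card_Un_Int[OF fin(3,4)] by simp
  hence c4: "card (U - (F \<union> G)) = card (U - (F' \<union> G'))"
    using U sub fin by (simp add: card_Diff_subset)
  obtain b1 where b1: "b1 ` (F \<inter> G) = F' \<inter> G'"
    using finite_same_card_bij[OF _ _ c1] fin bij_betw_imp_surj_on by blast
  obtain b2 where b2: "b2 ` (F - G) = F' - G'"
    using finite_same_card_bij[OF _ _ cards(3)] fin bij_betw_imp_surj_on by blast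
  obtain b3 where b3: "b3 ` (G - F) = G' - F'"
    using finite_same_card_bij[OF _ _ c3] fin bij_betw_imp_surj_on by blast
  obtain b4 where b4: "b4 ` (U - (F \<union> G)) = U - (F' \<union> G')"
    using finite_same_card_bij[OF _ _ c4] U bij_betw_imp_surj_on by blast
  define \<pi> where "\<pi> x = (if x \<in> F then if x \<in> G then b1 x else b2 x
                          else if x \<in> G then b3 x else b4 x)" for x
  have p1: "\<pi> ` (F \<inter> G) = F' \<inter> G'" unfolding b1[symmetric] by (rule image_cong) (auto simp: \<pi>_def)
  have p2: "\<pi> ` (F - G) = F' - G'" unfolding b2[symmetric] by (rule image_cong) (auto simp: \<pi>_def)
  have p3: "\<pi> ` (G - F) = G' - F'" unfolding b3[symmetric] by (rule image_cong) (auto simp: \<pi>_def)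
  have p4: "\<pi> ` (U - (F \<union> G)) = U - (F' \<union> G')" unfolding b4[symmetric] by (rule image_cong) (auto simp: \<pi>_def)
  have F: "\<pi> ` F = F'"
  proof -
    have "\<pi> ` F = \<pi> ` ((F \<inter> G) \<union> (F - G))" by (rule arg_cong[of _ _ "image \<pi>"]) blast
    also have "\<dots> = F'" unfolding image_Un p1 p2 by blast
    finally show ?thesis .
  qed
  have G: "\<pi> ` G = G'"
  proof -
    have "\<pi> ` G = \<pi> ` ((F \<inter> G) \<union> (G - F))" by (rule arg_cong[of _ _ "image \<pi>"]) blast
    also have "\<dots> = G'" unfolding image_Un p1 p3 by blast
    finally show ?thesis .
  qed
  have "\<pi> ` U = \<pi> ` (F \<union> G \<union> (U - (F \<union> G)))"
    by (rule arg_cong[of _ _ "image \<pi>"]) (use sub in blast)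
  also have "\<dots> = U" unfolding image_Un F G p4 using sub by blast
  finally have S: "\<pi> ` U = U" .
  hence "inj_on \<pi> U" using U by (intro eq_card_imp_inj_on) simp_all
  thus thesis using S F G by (rule that)
qed

section \<open>The layers of the cube\<close>

definition level :: "nat \<Rightarrow> nat \<Rightarrow> nat \<Rightarrow> nat set set" where
  "level n k i = {A. A \<subseteq> {1..n} \<and> int (card A) = \<lfloor>(real n - real k) / 2\<rfloor> + int i}"

lemma middle_layers_eq: "middle_layers n k = (\<Union>i\<in>{1..k}. level n k i)"
  by (simp add: middle_layers_def level_def)

lemma middle_layers_subset: "A \<in> middle_layers n k \<Longrightarrow> A \<subseteq> {1..n}"
  by (auto simp: middle_layers_eq level_def)

lemma card_diff_middle_layers:
  assumes "A \<in> middle_layers n k" "B \<in> middle_layers n k" "A \<subseteq> B \<or> B \<subseteq> A"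
  shows "card (A - B) \<le> k"
proof (cases "A \<subseteq> B")
  case False
  hence BA: "B \<subseteq> A" using assms(3) by blast
  obtain i j where "i \<le> k" "int (card A) = \<lfloor>(real n - real k) / 2\<rfloor> + int i"
    "int (card B) = \<lfloor>(real n - real k) / 2\<rfloor> + int j"
    using assms(1,2) unfolding middle_layers_eq level_def by auto
  moreover have "finite B"
    using middle_layers_subset[OF assms(2)] by (rule finite_subset) simp
  ultimately show ?thesis using BA by (simp add: card_Diff_subset)
next
  case True
  hence "A - B = {}" by blast
  thus ?thesis by (simp only: card.empty)
qed

lemma floor_half_diff: "\<lfloor>(real n - real k) / 2\<rfloor> = (int n - int k) div 2"
  using floor_divide_of_int_eq[of "int n - int k" 2, where 'a = real] by simp

text \<open>
  When \<open>n\<close> grows by 1, the sizes of the middle layers stay the same or all grow by 1. Accordingly the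
  new element \<open>Suc n\<close> is left out of every set or added to every set.
\<close>

lemma level_Suc:
  obtains B where "B \<subseteq> {Suc n}" "\<And>A i. A \<in> level n k i \<Longrightarrow> A \<union> B \<in> level (Suc n) k i"
proof -
  have "\<lfloor>(real (Suc n) - real k) / 2\<rfloor> = \<lfloor>(real n - real k) / 2\<rfloor> \<or>
        \<lfloor>(real (Suc n) - real k) / 2\<rfloor> = \<lfloor>(real n - real k) / 2\<rfloor> + 1"
    unfolding floor_half_diff by presburger
  thus thesis
  proof
    assume "\<lfloor>(real (Suc n) - real k) / 2\<rfloor> = \<lfloor>(real n - real k) / 2\<rfloor>"
    hence "A \<union> {} \<in> level (Suc n) k i" if "A \<in> level n k i" for A i
      using that by (auto simp: level_def)
    thus thesis by (intro that[of "{}"]) auto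
  next
    assume eq: "\<lfloor>(real (Suc n) - real k) / 2\<rfloor> = \<lfloor>(real n - real k) / 2\<rfloor> + 1"
    have "A \<union> {Suc n} \<in> level (Suc n) k i" if "A \<in> level n k i" for A i
    proof -
      have A: "A \<subseteq> {1..n}" "int (card A) = \<lfloor>(real n - real k) / 2\<rfloor> + int i"
        using that by (auto simp: level_def)
      have "finite A" using A(1) finite_subset by blast
      moreover have "Suc n \<notin> A" using A(1) by auto
      ultimately have "card (A \<union> {Suc n}) = card A + 1" by simp
      moreover have "A \<union> {Suc n} \<subseteq> {1..Suc n}" using A(1) by auto
      ultimately show ?thesis using A(2) eq unfolding level_def by simp
    qed
    thus thesis by (intro that[of "{Suc n}"]) auto
  qed
qed

section \<open>Chromatic numbers of copy graphs\<close>

definition copy_graph :: "('b set set \<Rightarrow> bool) \<Rightarrow> 'b set set \<Rightarrow> 'b set pair_pre_digraph" where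
  "copy_graph cp \<F> =
    \<lparr> pverts = \<F>,
      parcs = {(F, G). F \<in> \<F> \<and> G \<in> \<F> \<and> F \<noteq> G \<and> (\<exists>\<G>\<subseteq>\<F>. cp \<G> \<and> F \<in> \<G> \<and> G \<in> \<G>)} \<rparr>"

lemma chromatic_number_le: "proper_coloring G c f \<Longrightarrow> chromatic_number G \<le> c"
  unfolding chromatic_number_def by (intro Least_le) blast

lemma chromatic_number_attained:
  "proper_coloring G c f \<Longrightarrow> \<exists>g. proper_coloring G (chromatic_number G) g"
  unfolding chromatic_number_def by (rule LeastI_ex) blast

text \<open>
  The two features common to weak and strong copies: they are preserved by maps that preserve and
  reflect inclusion, and in the middle layers the distances inside one copy are bounded
  independently of \<open>n\<close>.
\<close>

locale copy_notion =
  fixes cp :: "nat set set \<Rightarrow> bool" and k L :: nat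
  assumes transport: "cp \<G> \<Longrightarrow> (\<And>A B. A \<in> \<G> \<Longrightarrow> B \<in> \<G> \<Longrightarrow> \<phi> A \<subseteq> \<phi> B \<longleftrightarrow> A \<subseteq> B) \<Longrightarrow> cp (\<phi> ` \<G>)"
    and diameter: "cp \<G> \<Longrightarrow> \<G> \<subseteq> middle_layers n k \<Longrightarrow> F \<in> \<G> \<Longrightarrow> G \<in> \<G> \<Longrightarrow> card (F - G) \<le> L"
    and k_pos: "k > 0"
begin

definition copy_distance :: "nat \<Rightarrow> nat \<Rightarrow> nat \<Rightarrow> bool" where
  "copy_distance n i a \<longleftrightarrow> (\<exists>\<G> F G. cp \<G> \<and> \<G> \<subseteq> middle_layers n k \<and> F \<in> \<G> \<and> G \<in> \<G> \<and>
     F \<in> level n k i \<and> G \<in> level n k i \<and> card (F - G) = a)"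

lemma copy_distance_Suc:
  assumes "copy_distance n i a"
  shows "copy_distance (Suc n) i a"
proof -
  obtain \<G> F G where G: "cp \<G>" "\<G> \<subseteq> middle_layers n k" "F \<in> \<G>" "G \<in> \<G>"
     "F \<in> level n k i" "G \<in> level n k i" "card (F - G) = a"
    using assms unfolding copy_distance_def by blast
  obtain B where B: "B \<subseteq> {Suc n}" "\<And>A i. A \<in> level n k i \<Longrightarrow> A \<union> B \<in> level (Suc n) k i"
    by (rule level_Suc[of n k]) (rule that)
  have disj: "A \<inter> B = {}" if "A \<in> \<G>" for A
    using middle_layers_subset[of A n k] G(2) that B(1) by fastforce
  have "cp ((\<lambda>A. A \<union> B) ` \<G>)"
  proof (rule transport[OF G(1)])
    show "A \<union> B \<subseteq> A' \<union> B \<longleftrightarrow> A \<subseteq> A'" if "A \<in> \<G>" "A' \<in> \<G>" for A A'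
      using disj[OF that(1)] by blast
  qed
  moreover have "(\<lambda>A. A \<union> B) ` \<G> \<subseteq> middle_layers (Suc n) k"
    using G(2) B(2) unfolding middle_layers_eq by blast
  moreover have "card ((F \<union> B) - (G \<union> B)) = a"
  proof -
    have "(F \<union> B) - (G \<union> B) = F - G" using disj[OF G(3)] by blast
    thus ?thesis using G(7) by simp
  qed
  ultimately show ?thesis
    unfolding copy_distance_def using G(3-6) B(2)
    by (intro exI[of _ "(\<lambda>A. A \<union> B) ` \<G>"] exI[of _ "F \<union> B"] exI[of _ "G \<union> B"]) simp
qed

lemma copy_distance_mono: "copy_distance n i a \<Longrightarrow> n \<le> n' \<Longrightarrow> copy_distance n' i a"
  by (rotate_tac, induction n' rule: nat_induct_at_least) (auto intro: copy_distance_Suc)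

text \<open>
  By symmetry of the ground set: a permutation carries the pair that witnesses the distance to any
  other pair in the same layer with the same distance.
\<close>

lemma copy_distance_adjacent:
  assumes "copy_distance n i a" "a > 0" "i \<in> {1..k}"
    and FG: "F \<in> level n k i" "G \<in> level n k i" "card (F - G) = a"
  shows "(F, G) \<in> parcs (copy_graph cp (middle_layers n k))"
proof -
  obtain \<G> F0 G0 where G: "cp \<G>" "\<G> \<subseteq> middle_layers n k" "F0 \<in> \<G>" "G0 \<in> \<G>"
     "F0 \<in> level n k i" "G0 \<in> level n k i" "card (F0 - G0) = a"
    using assms unfolding copy_distance_def by blast
  obtain \<pi> where \<pi>: "inj_on \<pi> {1..n}" "\<pi> ` {1..n} = {1..n}" "\<pi> ` F0 = F" "\<pi> ` G0 = G"
    by (rule permutation_between_pairs[of "{1..n}" F0 G0 F G])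
       (use FG G(5-7) that in \<open>auto simp: level_def\<close>)
  have sub: "A \<subseteq> {1..n}" if "A \<in> \<G>" for A using middle_layers_subset G(2) that by blast
  have "cp ((`) \<pi> ` \<G>)"
  proof (rule transport[OF G(1)])
    show "\<pi> ` A \<subseteq> \<pi> ` A' \<longleftrightarrow> A \<subseteq> A'" if "A \<in> \<G>" "A' \<in> \<G>" for A A'
    proof -
      have "\<pi> x \<in> \<pi> ` A' \<longleftrightarrow> x \<in> A'" if "x \<in> A" for x
        using inj_on_image_mem_iff[OF \<pi>(1) _ sub] sub \<open>A \<in> \<G>\<close> \<open>A' \<in> \<G>\<close> that by blast
      thus ?thesis by (auto simp: image_subset_iff)
    qed
  qed
  moreover have "(`) \<pi> ` \<G> \<subseteq> middle_layers n k"
  proof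
    fix A' assume "A' \<in> (`) \<pi> ` \<G>"
    then obtain A where A: "A \<in> \<G>" "A' = \<pi> ` A" by blast
    have "card A' = card A"
      unfolding A(2) by (rule card_image) (rule inj_on_subset[OF \<pi>(1) sub[OF A(1)]])
    moreover have "A' \<subseteq> {1..n}" using image_mono[OF sub[OF A(1)], of \<pi>] A(2) \<pi>(2) by simp
    moreover have "A \<in> middle_layers n k" using A G(2) by blast
    ultimately show "A' \<in> middle_layers n k" by (auto simp: middle_layers_eq level_def)
  qed
  moreover have "F \<in> (`) \<pi> ` \<G>" "G \<in> (`) \<pi> ` \<G>" using \<pi>(3,4) G(3,4) by blast+
  moreover have "F \<noteq> G" using FG(3) \<open>a > 0\<close> by auto
  moreover have "F \<in> middle_layers n k" "G \<in> middle_layers n k"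
    using FG \<open>i \<in> {1..k}\<close> by (auto simp: middle_layers_eq)
  ultimately show ?thesis unfolding copy_graph_def by auto
qed

text \<open>
  The colour is a two-digit number in base \<open>(2 * n) ^ m\<close>: the leading digit tells the layer, the other
  one separates the sets at distance at most \<open>m\<close> within it.
\<close>

lemma copy_graph_colouring:
  assumes "n > 0" and m: "\<And>i a. copy_distance n i a \<Longrightarrow> a \<le> m"
  shows "\<exists>f. proper_coloring (copy_graph cp (middle_layers n k)) (k * (2 * n) ^ m) f"
proof -
  obtain c where c: "\<And>F. F \<subseteq> {1..n} \<Longrightarrow> c F < (2 * n) ^ m"
    "\<And>F G. F \<subseteq> {1..n} \<Longrightarrow> G \<subseteq> {1..n} \<Longrightarrow> card F = card G \<Longrightarrow> F \<noteq> G \<Longrightarrow> card (F - G) \<le> m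
       \<Longrightarrow> c F \<noteq> c G"
    by (rule separating_colouring[OF assms(1), of m]) (rule that)
  define M where "M = (2 * n) ^ m"
  define idx where "idx F = nat (int (card F) - \<lfloor>(real n - real k) / 2\<rfloor> - 1)" for F :: "nat set"
  have idx: "F \<in> level n k (Suc (idx F))" "idx F < k" if "F \<in> middle_layers n k" for F
    using that by (auto simp: middle_layers_eq level_def idx_def)
  define f where "f F = idx F * M + c F" for F
  have cM: "c F < M" if "F \<in> middle_layers n k" for F
    using c(1)[OF middle_layers_subset[OF that]] by (simp add: M_def)
  have "f F < k * M" if "F \<in> middle_layers n k" for F
  proof -
    have "f F < Suc (idx F) * M" using cM[OF that] by (simp add: f_def)
    also have "\<dots> \<le> k * M" using idx(2)[OF that] by (intro mult_right_mono) auto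
    finally show ?thesis .
  qed
  moreover have "f F \<noteq> f G" if "(F, G) \<in> parcs (copy_graph cp (middle_layers n k))" for F G
  proof
    assume eq: "f F = f G"
    from that obtain \<G> where FG: "F \<in> middle_layers n k" "G \<in> middle_layers n k" "F \<noteq> G"
      "\<G> \<subseteq> middle_layers n k" "cp \<G>" "F \<in> \<G>" "G \<in> \<G>" unfolding copy_graph_def by auto
    have "f H div M = idx H" "f H mod M = c H" if "H \<in> middle_layers n k" for H
      using cM[OF that] by (simp_all add: f_def)
    hence e: "idx F = idx G" "c F = c G" using eq FG(1,2) by metis+
    have lv: "F \<in> level n k (Suc (idx F))" "G \<in> level n k (Suc (idx F))"
      using idx(1)[OF FG(1)] idx(1)[OF FG(2)] e(1) by simp_all
    hence "copy_distance n (Suc (idx F)) (card (F - G))"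
      unfolding copy_distance_def using FG by blast
    hence "card (F - G) \<le> m" by (rule m)
    moreover have "card F = card G" using lv by (simp add: level_def)
    ultimately show False
      using c(2)[of F G] middle_layers_subset[OF FG(1)] middle_layers_subset[OF FG(2)] FG(3) e(2) by simp
  qed
  ultimately have "proper_coloring (copy_graph cp (middle_layers n k)) (k * (2 * n) ^ m) f"
    unfolding M_def[symmetric] proper_coloring_def by (auto simp: copy_graph_def)
  thus ?thesis by blast
qed

lemma chromatic_number_copy_graph_pos:
  assumes "2 * k \<le> n" "proper_coloring (copy_graph cp (middle_layers n k)) c f"
  shows "c > 0"
proof -
  define h where "h = nat (\<lfloor>(real n - real k) / 2\<rfloor> + 1)"
  have "\<lfloor>(real n - real k) / 2\<rfloor> \<ge> 0" using assms by simp
  moreover have "\<lfloor>(real n - real k) / 2\<rfloor> + 1 \<le> int n"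
    unfolding floor_half_diff using assms(1) k_pos by presburger
  ultimately have "h \<le> n" "int h = \<lfloor>(real n - real k) / 2\<rfloor> + int 1" by (auto simp: h_def)
  hence "{1..h} \<in> level n k 1" by (auto simp: level_def)
  hence "{1..h} \<in> middle_layers n k" using k_pos by (auto simp: middle_layers_eq)
  thus ?thesis using assms(2) by (fastforce simp: proper_coloring_def copy_graph_def)
qed

text \<open>
  A distance that occurs once in the \<open>i\<close>-th layer occurs there for all larger \<open>n\<close>, and then all pairs
  at this distance are adjacent. With \<open>q = n div (4 * t)\<close> the blocks take up at most a quarter of the
  ground set, which leaves room to fill up the sets to about half of it.
\<close>

lemma exact_distance_lower_bound:
  assumes "a > 0" "i \<in> {1..k}" "copy_distance n0 i a"
  obtains \<delta> n1 where "\<delta> > (0::real)" "\<And>n c f. n1 \<le> n \<Longrightarrow>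
    proper_coloring (copy_graph cp (middle_layers n k)) c f \<Longrightarrow> \<delta> * real n ^ a \<le> real c"
proof (rule exact_distance_colours[OF assms(1)])
  fix t K :: nat
  assume t: "t > 0" and bound: "\<And>n h q M (f :: nat set \<Rightarrow> nat).
    q > 0 \<Longrightarrow> t \<le> h \<Longrightarrow> t * q + h \<le> n + t \<Longrightarrow>
    (\<And>F. F \<subseteq> {1..n} \<Longrightarrow> card F = h \<Longrightarrow> f F < M) \<Longrightarrow>
    (\<And>F G. F \<subseteq> {1..n} \<Longrightarrow> G \<subseteq> {1..n} \<Longrightarrow> card F = h \<Longrightarrow> card G = h \<Longrightarrow> card (F - G) = a \<Longrightarrow> f F \<noteq> f G)
    \<Longrightarrow> q ^ a \<le> K * M"
  define E where "E = (8 * real t) ^ a * (real K + 1)"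
  have E: "E > 0" using t by (simp add: E_def)
  hence "1 / E > 0" by simp
  moreover have "1 / E * real n ^ a \<le> real c"
    if n: "n0 + 8 * t + 2 * k \<le> n" and f: "proper_coloring (copy_graph cp (middle_layers n k)) c f" for n c f
  proof -
    define q where "q = n div (4 * t)"
    define fl where "fl = \<lfloor>(real n - real k) / 2\<rfloor>"
    define h where "h = nat (fl + int i)"
    have fl: "2 * fl \<le> int n - int k" "int n - int k < 2 * fl + 2" unfolding fl_def floor_half_diff by presburger+
    have ik: "1 \<le> i" "i \<le> k" using assms(2) by auto
    have q4: "4 * (t * q) \<le> n" unfolding q_def
      by (metis mult.assoc div_times_less_eq_dividend mult.commute)
    have q4': "n < 4 * (t * q) + 4 * t"
    proof -
      have "n = 4 * t * q + n mod (4 * t)" by (simp add: q_def)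
      moreover have "n mod (4 * t) < 4 * t" using t by simp
      ultimately show ?thesis by linarith
    qed
    have q: "q > 0" using q4' n t by (cases "q = 0") auto
    have hi: "int h = fl + int i" using fl ik n unfolding h_def by linarith
    have h: "t \<le> h" "t * q + h \<le> n + t" using fl ik n hi q4 by linarith+
    have lev: "F \<in> level n k i" if "F \<subseteq> {1..n}" "card F = h" for F
      using that hi by (simp add: level_def fl_def)
    have cd: "copy_distance n i a" by (rule copy_distance_mono[OF assms(3)]) (use n in simp)
    have "q ^ a \<le> K * c"
    proof (rule bound[OF q h])
      show "f F < c" if "F \<subseteq> {1..n}" "card F = h" for F
        using lev[OF that] assms(2) f by (auto simp: proper_coloring_def copy_graph_def middle_layers_eq)
      show "f F \<noteq> f G" if "F \<subseteq> {1..n}" "G \<subseteq> {1..n}" "card F = h" "card G = h" "card (F - G) = a" for F G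
        using copy_distance_adjacent[OF cd assms(1,2) lev[OF that(1,3)] lev[OF that(2,4)] that(5)] f
        unfolding proper_coloring_def by blast
    qed
    hence qa: "real q ^ a \<le> real K * real c" by (metis of_nat_le_iff of_nat_mult of_nat_power)
    have "n \<le> 8 * t * q"
      using q4' n by linarith
    hence "real n \<le> 8 * real t * real q" by (metis of_nat_le_iff of_nat_mult of_nat_numeral)
    hence "real n ^ a \<le> (8 * real t * real q) ^ a" by (intro power_mono) auto
    also have "\<dots> = (8 * real t) ^ a * real q ^ a" by (simp add: power_mult_distrib)
    also have "\<dots> \<le> (8 * real t) ^ a * ((real K + 1) * real c)"
      using qa by (intro mult_left_mono) (auto simp: algebra_simps)
    also have "\<dots> = E * real c" by (simp add: E_def)
    finally show ?thesis using E by (simp add: divide_le_eq mult.commute)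
  qed
  ultimately show thesis by (rule that[of "1 / E" "n0 + 8 * t + 2 * k"])
qed

theorem chromatic_number_bigtheta:
  "\<exists>m. (\<lambda>n. real (chromatic_number (copy_graph cp (middle_layers n k)))) \<in> \<Theta>(\<lambda>n. real n ^ m)"
proof -
  let ?\<chi> = "\<lambda>n. chromatic_number (copy_graph cp (middle_layers n k))"
  define D where "D = insert 0 {a. \<exists>n i. i \<in> {1..k} \<and> copy_distance n i a}"
  define m where "m = Max D"
  have "a \<le> L" if "copy_distance n i a" for n i a
    using that diameter unfolding copy_distance_def by blast
  hence "D \<subseteq> {..L}" by (auto simp: D_def)
  hence finD: "finite D" using finite_subset by blast
  have le_m: "a \<le> m" if "copy_distance n i a" for n i a
  proof (cases "i \<in> {1..k}")
    case True
    hence "a \<in> D" using that by (auto simp: D_def)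
    thus ?thesis using finD by (simp add: m_def)
  next
    case False
    obtain \<G> F where "\<G> \<subseteq> middle_layers n k" "F \<in> \<G>" "F \<in> level n k i"
      using \<open>copy_distance n i a\<close> unfolding copy_distance_def by blast
    hence "i \<in> {1..k}" by (auto simp: middle_layers_eq level_def)
    thus ?thesis using False by contradiction
  qed
  have col: "\<exists>f. proper_coloring (copy_graph cp (middle_layers n k)) (k * (2 * n) ^ m) f" if "n > 0" for n
    using that le_m by (rule copy_graph_colouring)
  have upper: "real (?\<chi> n) \<le> real (k * 2 ^ m) * real n ^ m" if "n > 0" for n
  proof -
    have "?\<chi> n \<le> k * (2 * n) ^ m" using col[OF that] chromatic_number_le by blast
    hence "real (?\<chi> n) \<le> real (k * (2 * n) ^ m)" by (rule of_nat_mono)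
    thus ?thesis by (simp add: power_mult_distrib mult.assoc)
  qed
  have att: "\<exists>g. proper_coloring (copy_graph cp (middle_layers n k)) (?\<chi> n) g" if "n > 0" for n
    using col[OF that] chromatic_number_attained by blast
  obtain \<delta> n1 where \<delta>: "\<delta> > (0::real)" "\<And>n. n1 \<le> n \<Longrightarrow> n > 0 \<Longrightarrow> \<delta> * real n ^ m \<le> real (?\<chi> n)"
  proof (cases "m = 0")
    case True
    have "1 * real n ^ m \<le> real (?\<chi> n)" if "2 * k \<le> n" "n > 0" for n
      using chromatic_number_copy_graph_pos[OF that(1)] att[OF that(2)] True by force
    thus thesis by (intro that[of 1 "2 * k"]) auto
  next
    case False
    have "m \<in> D" unfolding m_def using finD by (intro Max_in) (auto simp: D_def)
    then obtain n0 i where "i \<in> {1..k}" "copy_distance n0 i m" using False by (auto simp: D_def)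
    then obtain \<delta> n1 where d: "\<delta> > (0::real)" "\<And>n c f. n1 \<le> n \<Longrightarrow>
      proper_coloring (copy_graph cp (middle_layers n k)) c f \<Longrightarrow> \<delta> * real n ^ m \<le> real c"
      using False by (elim exact_distance_lower_bound[rotated]) (auto intro: that)
    show thesis by (rule that[OF d(1), of n1]) (use d(2) att in blast)
  qed
  have "eventually (\<lambda>n. \<delta> * norm (real n ^ m) \<le> norm (real (?\<chi> n)) \<and>
      norm (real (?\<chi> n)) \<le> real (k * 2 ^ m) * norm (real n ^ m)) at_top"
    using eventually_ge_at_top[of "max 1 n1"]
  proof eventually_elim
    case (elim n)
    thus ?case using \<delta>(2)[of n] upper[of n] by simp
  qed
  moreover have "real (k * 2 ^ m) > 0" using k_pos by simp
  ultimately show ?thesis using \<delta>(1) by (intro exI[of _ m] bigthetaI')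
qed

end

section \<open>Weak and strong copies\<close>

lemma connected_poset_rtrancl:
  assumes "connected_poset P r" "p \<in> P" "q \<in> P"
  shows "(p, q) \<in> {(x, y). x \<in> P \<and> y \<in> P \<and> ((x, y) \<in> r \<or> (y, x) \<in> r)}\<^sup>*"
proof -
  let ?H = "with_proj (hasse_diagram P r)"
  have "p \<rightarrow>\<^sup>*\<^bsub>mk_symmetric ?H\<^esub> q"
    using assms unfolding connected_poset_def connected_def strongly_connected_def
    by (simp add: hasse_diagram_def mk_symmetric_def)
  hence "(p, q) \<in> (parcs (mk_symmetric ?H))\<^sup>*"
    unfolding reachable_def by (auto dest: rtrancl_on_rtranclI)
  moreover have "parcs (mk_symmetric ?H) \<subseteq> {(x, y). x \<in> P \<and> y \<in> P \<and> ((x, y) \<in> r \<or> (y, x) \<in> r)}"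
    by (auto simp: mk_symmetric_def hasse_diagram_def)
  ultimately show ?thesis using rtrancl_mono by blast
qed

text \<open>
  Comparable members of the middle layers differ by at most \<open>k\<close> elements. The bound for \<open>p\<close> and \<open>q\<close>
  adds up along a path from \<open>p\<close> to \<open>q\<close> and does not depend on the copy, and there are finitely many
  pairs \<open>p\<close>, \<open>q\<close>.
\<close>

lemma weak_copy_diameter:
  fixes P :: "'a set"
  assumes "finite P" "connected_poset P r"
  obtains L where "\<And>n \<G> F G. weak_copy P r \<G> \<Longrightarrow> \<G> \<subseteq> middle_layers n k \<Longrightarrow> F \<in> \<G> \<Longrightarrow> G \<in> \<G>
    \<Longrightarrow> card (F - G) \<le> L"
proof -
  define emb where "emb n \<iota> \<longleftrightarrow> (\<forall>p\<in>P. \<iota> p \<in> middle_layers n k) \<and>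
    (\<forall>p\<in>P. \<forall>q\<in>P. (p, q) \<in> r \<longrightarrow> \<iota> p \<subseteq> \<iota> q)" for n and \<iota> :: "'a \<Rightarrow> nat set"
  have "\<exists>l. \<forall>n \<iota>. emb n \<iota> \<longrightarrow> card (\<iota> p - \<iota> q) \<le> l" if "p \<in> P" "q \<in> P" for p q
    using connected_poset_rtrancl[OF assms(2) that]
  proof induction
    case base
    show ?case by (intro exI[of _ 0]) simp
  next
    case (step y z)
    then obtain l where l: "\<And>n \<iota>. emb n \<iota> \<Longrightarrow> card (\<iota> p - \<iota> y) \<le> l" by blast
    have "card (\<iota> p - \<iota> z) \<le> l + k" if "emb n \<iota>" for n \<iota>
    proof -
      have yz: "\<iota> y \<in> middle_layers n k" "\<iota> z \<in> middle_layers n k" "\<iota> y \<subseteq> \<iota> z \<or> \<iota> z \<subseteq> \<iota> y"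
        using that step(2) by (auto simp: emb_def)
      have fin: "finite (\<iota> x)" if "x \<in> P" for x
        using middle_layers_subset[of "\<iota> x" n k] \<open>emb n \<iota>\<close> that finite_subset[of "\<iota> x" "{1..n}"]
        by (simp add: emb_def)
      have "card (\<iota> p - \<iota> z) \<le> card ((\<iota> p - \<iota> y) \<union> (\<iota> y - \<iota> z))"
        using fin[OF \<open>p \<in> P\<close>] fin[of y] step(2) by (intro card_mono) auto
      also have "\<dots> \<le> card (\<iota> p - \<iota> y) + card (\<iota> y - \<iota> z)" by (rule card_Un_le)
      also have "\<dots> \<le> l + k" using l[OF that] card_diff_middle_layers[OF yz] by (rule add_mono)
      finally show ?thesis .
    qed
    thus ?case by blast
  qed
  then obtain l where l: "\<And>p q n \<iota>. p \<in> P \<Longrightarrow> q \<in> P \<Longrightarrow> emb n \<iota> \<Longrightarrow> card (\<iota> p - \<iota> q) \<le> l p q"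
    by metis
  have "card (F - G) \<le> (\<Sum>p\<in>P. \<Sum>q\<in>P. l p q)"
    if copy: "weak_copy P r \<G>" and G: "\<G> \<subseteq> middle_layers n k" "F \<in> \<G>" "G \<in> \<G>" for n \<G> F G
  proof -
    obtain \<iota> where \<iota>: "bij_betw \<iota> P \<G>" "\<forall>p\<in>P. \<forall>q\<in>P. (p, q) \<in> r \<longrightarrow> \<iota> p \<subseteq> \<iota> q"
      using copy unfolding weak_copy_def by blast
    have im: "\<iota> ` P = \<G>" using \<iota>(1) by (rule bij_betw_imp_surj_on)
    hence "emb n \<iota>" using \<iota>(2) G(1) by (auto simp: emb_def)
    obtain p q where pq: "p \<in> P" "q \<in> P" "F = \<iota> p" "G = \<iota> q" using im G(2,3) by blast
    have "card (F - G) \<le> l p q" using l[OF pq(1,2) \<open>emb n \<iota>\<close>] pq(3,4) by simp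
    also have "\<dots> \<le> (\<Sum>q\<in>P. l p q)" using assms(1) pq by (intro member_le_sum) auto
    also have "\<dots> \<le> (\<Sum>p\<in>P. \<Sum>q\<in>P. l p q)"
      using assms(1) pq by (intro member_le_sum[of p P "\<lambda>p. \<Sum>q\<in>P. l p q"]) auto
    finally show ?thesis .
  qed
  thus thesis by (rule that)
qed

lemma strong_copy_imp_weak_copy: "strong_copy P r \<G> \<Longrightarrow> weak_copy P r \<G>"
  unfolding strong_copy_def weak_copy_def by blast

lemma bij_betw_order_embedding:
  assumes "bij_betw \<iota> P \<G>" "\<And>A B. A \<in> \<G> \<Longrightarrow> B \<in> \<G> \<Longrightarrow> \<phi> A \<subseteq> \<phi> B \<longleftrightarrow> A \<subseteq> B"
  shows "bij_betw (\<phi> \<circ> \<iota>) P (\<phi> ` \<G>)"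
proof (rule bij_betw_trans[OF assms(1)])
  have "inj_on \<phi> \<G>" by (rule inj_onI) (metis assms(2) subset_antisym subset_refl)
  thus "bij_betw \<phi> \<G> (\<phi> ` \<G>)" by (rule inj_on_imp_bij_betw)
qed

lemma weak_copy_transport:
  assumes "weak_copy P r \<G>" "\<And>A B. A \<in> \<G> \<Longrightarrow> B \<in> \<G> \<Longrightarrow> \<phi> A \<subseteq> \<phi> B \<longleftrightarrow> A \<subseteq> B"
  shows "weak_copy P r (\<phi> ` \<G>)"
proof -
  obtain \<iota> where \<iota>: "bij_betw \<iota> P \<G>" "\<forall>p\<in>P. \<forall>q\<in>P. (p, q) \<in> r \<longrightarrow> \<iota> p \<subseteq> \<iota> q"
    using assms(1) unfolding weak_copy_def by blast
  have "\<forall>p\<in>P. \<forall>q\<in>P. (p, q) \<in> r \<longrightarrow> (\<phi> \<circ> \<iota>) p \<subseteq> (\<phi> \<circ> \<iota>) q"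
    using \<iota>(2) assms(2) bij_betwE[OF \<iota>(1)] by simp
  thus ?thesis unfolding weak_copy_def using bij_betw_order_embedding[OF \<iota>(1) assms(2)] by blast
qed

lemma strong_copy_transport:
  assumes "strong_copy P r \<G>" "\<And>A B. A \<in> \<G> \<Longrightarrow> B \<in> \<G> \<Longrightarrow> \<phi> A \<subseteq> \<phi> B \<longleftrightarrow> A \<subseteq> B"
  shows "strong_copy P r (\<phi> ` \<G>)"
proof -
  obtain \<iota> where \<iota>: "bij_betw \<iota> P \<G>" "\<forall>p\<in>P. \<forall>q\<in>P. (p, q) \<in> r \<longleftrightarrow> \<iota> p \<subseteq> \<iota> q"
    using assms(1) unfolding strong_copy_def by blast
  have "\<forall>p\<in>P. \<forall>q\<in>P. (p, q) \<in> r \<longleftrightarrow> (\<phi> \<circ> \<iota>) p \<subseteq> (\<phi> \<circ> \<iota>) q"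
    using \<iota>(2) assms(2) bij_betwE[OF \<iota>(1)] by simp
  thus ?thesis unfolding strong_copy_def using bij_betw_order_embedding[OF \<iota>(1) assms(2)] by blast
qed

theorem proposition1p8:
  fixes P :: "'a set" and r :: "'a rel" and k :: nat
  assumes "finite P"
    and "partial_order_on P r"
    and "connected_poset P r"
    and "\<not> total_on P r"
    and "k > 0"
  shows "\<exists>m m' :: nat.
    (\<lambda>n::nat. real (chromatic_number (weak_copy_graph P r (middle_layers n k))))
      \<in> \<Theta>(\<lambda>n. real n ^ m) \<and>
    (\<lambda>n::nat. real (chromatic_number (strong_copy_graph P r (middle_layers n k))))
      \<in> \<Theta>(\<lambda>n. real n ^ m')"
proof -
  obtain L where L: "\<And>n \<G> F G. weak_copy P r \<G> \<Longrightarrow> \<G> \<subseteq> middle_layers n k \<Longrightarrow> F \<in> \<G> \<Longrightarrow> G \<in> \<G>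
    \<Longrightarrow> card (F - G) \<le> L"
    by (rule weak_copy_diameter[OF assms(1,3)]) (rule that)
  interpret weak: copy_notion "weak_copy P r" k L
    by standard (rule weak_copy_transport, assumption, assumption, erule L, assumption+, rule assms(5))
  interpret strong: copy_notion "strong_copy P r" k L
    by standard (rule strong_copy_transport, assumption, assumption,
      erule L[OF strong_copy_imp_weak_copy], assumption+, rule assms(5))
  have "weak_copy_graph P r \<F> = copy_graph (weak_copy P r) \<F>"
    "strong_copy_graph P r \<F> = copy_graph (strong_copy P r) \<F>" for \<F> :: "nat set set"
    by (simp_all add: weak_copy_graph_def strong_copy_graph_def copy_graph_def)
  thus ?thesis
    using weak.chromatic_number_bigtheta strong.chromatic_number_bigtheta by simp
qed

end
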